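(* The fundamental endomorphism $F:J^{k-1}_f(\mathbb{R};Gr(n,\mathbb{R}^{kn}))\to\mathfrak{gl}(kn)$, $$F([(A,\dot A,\dots,A^{(k-1)})])=\mathbf{A}\left(\begin{array}{cccccc}0&I&0&\cdots&0&0\\0&0&2I&\cdots&0&0\\ \vdots&\vdots&\vdots& &\vdots&\vdots\\0&0&0&\cdots&(k-2)I&0\\0&0&0&\cdots&0&(k-1)I\\0&0&0&\cdots&0&0\end{array}\right)\mathbf{A}^{-1},\qquad \mathbf{A}=(A|\dot A|\cdots|A^{(k-1)}),$$ is a diffeomorphism onto its image; in fact, $F$ is a $GL(kn)$-equivariant embedding of the space of $(k-1)$-jets as an adjoint orbit in the Lie algebra $\mathfrak{gl}(kn)$.
   Context: Let $n\ge1$, $k\ge2$ be integers; all blocks in the displayed matrix are $n\times n$. The space $J^{k-1}_f(\mathbb{R};M_{kn\times n})$ of $(k-1)$-jets of fanning frames is the set of tuples $(A,\dot A,\dots,A^{(k-1)})$ of real $kn\times n$ matrices such that the $kn\times kn$ matrix $(A|\dot A|\cdots|A^{(k-1)})$ is invertible. The group $J^{k-1}(\mathbb{R};GL(n))$ of jets $(X,\dot X,\dots,X^{(k-1)})$ of smooth curves of invertible $n\times n$ matrices (so $X\in GL(n)$, other entries arbitrary $n\times n$ matrices) acts on the right by the Leibniz rule: the $m$-th entry of $(A,\dots,A^{(k-1)})\cdot(X,\dots,X^{(k-1)})$ is $\sum_{i=0}^m\binom{m}{i}A^{(m-i)}X^{(i)}$. The space of $(k-1)$-jets of fanning curves $J^{k-1}_f(\mathbb{R};Gr(n,\mathbb{R}^{kn}))$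 is the quotient manifold of $J^{k-1}_f(\mathbb{R};M_{kn\times n})$ by this action. $GL(kn)$ acts on it by $T\cdot[(A,\dots,A^{(k-1)})]=[(TA,\dots,TA^{(k-1)})]$ and acts on $\mathfrak{gl}(kn)$ by the adjoint action $T\cdot M=TMT^{-1}$. The map $F$ does not depend on the chosen representative of the jet. *)

theory Defs
  imports "HOL-Analysis.Analysis"
begin

section \<open>Smooth manifolds\<close>

text \<open>\<^term>\<open>Ck_on m f S\<close> is the usual notion of a C^m map only for open \<^term>\<open>S\<close>;
  it is never used for other sets.\<close>

primrec Ck_on :: "nat \<Rightarrow> ('a::euclidean_space \<Rightarrow> 'b::euclidean_space) \<Rightarrow> 'a set \<Rightarrow> bool" where
  "Ck_on 0 f S \<longleftrightarrow> continuous_on S f"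
| "Ck_on (Suc m) f S \<longleftrightarrow>
     (\<forall>x\<in>S. f differentiable (at x)) \<and> (\<forall>v. Ck_on m (\<lambda>x. frechet_derivative f (at x) v) S)"

definition smooth_on :: "('a::euclidean_space \<Rightarrow> 'b::euclidean_space) \<Rightarrow> 'a set \<Rightarrow> bool" where
  "smooth_on f S \<longleftrightarrow> (\<forall>m. Ck_on m f S)"

text \<open>A chart is a pair of its domain and its coordinate map. Atlases need not be maximal.\<close>

type_synonym ('a, 'e) chart = "'a set \<times> ('a \<Rightarrow> 'e)"

definition smooth_manifold :: "'a topology \<Rightarrow> ('a, 'e::euclidean_space) chart set \<Rightarrow> bool" where
  "smooth_manifold X \<A> \<longleftrightarrow>
     Hausdorff_space X \<and> second_countable X \<and>
     (\<forall>(U, \<phi>)\<in>\<A>. openin X U \<and> open (\<phi> ` U) \<and>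
        homeomorphic_map (subtopology X U) (top_of_set (\<phi> ` U)) \<phi>) \<and>
     (\<Union>(U, \<phi>)\<in>\<A>. U) = topspace X \<and>
     (\<forall>(U, \<phi>)\<in>\<A>. \<forall>(V, \<psi>)\<in>\<A>. smooth_on (\<psi> \<circ> inv_into U \<phi>) (\<phi> ` (U \<inter> V)))"

abbreviation open_set_atlas :: "'a::euclidean_space set \<Rightarrow> ('a, 'a) chart set" where
  "open_set_atlas S \<equiv> {(S, id)}"

definition smooth_map ::
  "'a topology \<Rightarrow> ('a, 'e::euclidean_space) chart set \<Rightarrow>
   'b topology \<Rightarrow> ('b, 'f::euclidean_space) chart set \<Rightarrow> ('a \<Rightarrow> 'b) \<Rightarrow> bool" where
  "smooth_map X \<A> Y \<B> f \<longleftrightarrow>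
     continuous_map X Y f \<and>
     (\<forall>(U, \<phi>)\<in>\<A>. \<forall>(V, \<psi>)\<in>\<B>. smooth_on (\<psi> \<circ> f \<circ> inv_into U \<phi>) (\<phi> ` {x\<in>U. f x \<in> V}))"

definition submersion ::
  "'a topology \<Rightarrow> ('a, 'e::euclidean_space) chart set \<Rightarrow>
   'b topology \<Rightarrow> ('b, 'f::euclidean_space) chart set \<Rightarrow> ('a \<Rightarrow> 'b) \<Rightarrow> bool" where
  "submersion X \<A> Y \<B> f \<longleftrightarrow>
     smooth_map X \<A> Y \<B> f \<and>
     (\<forall>(U, \<phi>)\<in>\<A>. \<forall>(V, \<psi>)\<in>\<B>. \<forall>x\<in>U. f x \<in> V \<longrightarrow>
        surj (frechet_derivative (\<psi> \<circ> f \<circ> inv_into U \<phi>) (at (\<phi> x))))"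

definition immersion ::
  "'a topology \<Rightarrow> ('a, 'e::euclidean_space) chart set \<Rightarrow>
   'b topology \<Rightarrow> ('b, 'f::euclidean_space) chart set \<Rightarrow> ('a \<Rightarrow> 'b) \<Rightarrow> bool" where
  "immersion X \<A> Y \<B> f \<longleftrightarrow>
     smooth_map X \<A> Y \<B> f \<and>
     (\<forall>(U, \<phi>)\<in>\<A>. \<forall>(V, \<psi>)\<in>\<B>. \<forall>x\<in>U. f x \<in> V \<longrightarrow>
        inj (frechet_derivative (\<psi> \<circ> f \<circ> inv_into U \<phi>) (at (\<phi> x))))"

definition smooth_embedding ::
  "'a topology \<Rightarrow> ('a, 'e::euclidean_space) chart set \<Rightarrow>
   'b topology \<Rightarrow> ('b, 'f::euclidean_space) chart set \<Rightarrow> ('a \<Rightarrow> 'b) \<Rightarrow> bool" where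
  "smooth_embedding X \<A> Y \<B> f \<longleftrightarrow> immersion X \<A> Y \<B> f \<and> embedding_map X Y f"

definition diffeomorphism ::
  "'a topology \<Rightarrow> ('a, 'e::euclidean_space) chart set \<Rightarrow>
   'b topology \<Rightarrow> ('b, 'f::euclidean_space) chart set \<Rightarrow> ('a \<Rightarrow> 'b) \<Rightarrow> bool" where
  "diffeomorphism X \<A> Y \<B> f \<longleftrightarrow>
     (\<exists>g. homeomorphic_maps X Y f g \<and> smooth_map X \<A> Y \<B> f \<and> smooth_map Y \<B> X \<A> g)"

definition embedded_submanifold ::
  "'a set \<Rightarrow> ('a, 'e::euclidean_space) chart set \<Rightarrow>
   'a topology \<Rightarrow> ('a, 'f::euclidean_space) chart set \<Rightarrow> bool" where
  "embedded_submanifold S \<C> Y \<B> \<longleftrightarrow>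
     S \<subseteq> topspace Y \<and> smooth_manifold (subtopology Y S) \<C> \<and>
     smooth_embedding (subtopology Y S) \<C> Y \<B> id"

text \<open>\<^term>\<open>Y\<close> with the atlas \<^term>\<open>\<B>\<close> is the quotient manifold of \<^term>\<open>X\<close> by the equivalence
  relation \<^term>\<open>r\<close>: it carries the quotient topology and the smooth structure (necessarily unique)
  for which the projection is a submersion.\<close>

definition quotient_manifold ::
  "'a topology \<Rightarrow> ('a, 'e::euclidean_space) chart set \<Rightarrow> ('a \<times> 'a) set \<Rightarrow>
   'a set topology \<Rightarrow> ('a set, 'f::euclidean_space) chart set \<Rightarrow> bool" where
  "quotient_manifold X \<A> r Y \<B> \<longleftrightarrow>
     topspace Y = topspace X // r \<and> quotient_map X Y (\<lambda>x. r `` {x}) \<and>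
     smooth_manifold Y \<B> \<and> submersion X \<A> Y \<B> (\<lambda>x. r `` {x})"


section \<open>Jets of fanning frames and of fanning curves\<close>

text \<open>The index type \<^typ>\<open>'k\<close> of cardinality k, with its linear order, plays the role of
  0, ..., k - 1; \<^term>\<open>pos i\<close> is the number represented by \<^term>\<open>i\<close>. The space R^{kn} is
  \<^typ>\<open>real^('k \<times> 'n)\<close>, where the block of \<^term>\<open>(i, p)\<close> is \<^term>\<open>i\<close>. A jet is the vector
  of its k entries; \<^term>\<open>jet_entry a m\<close> is meaningful for m < k only.\<close>

definition pos :: "'k::{finite,linorder} \<Rightarrow> nat" where
  "pos i = card {..<i}"

definition jet_entry :: "('a, 'k::{finite,linorder}) vec \<Rightarrow> nat \<Rightarrow> 'a" where
  "jet_entry a m = a $ inv pos m"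

type_synonym ('n, 'k) frame_jet = "(((real, 'n) vec, 'k \<times> 'n) vec, 'k) vec"
type_synonym ('n, 'k) big_matrix = "((real, 'k \<times> 'n) vec, 'k \<times> 'n) vec"

definition juxtapose :: "('n::finite, 'k::{finite,linorder}) frame_jet \<Rightarrow> ('n, 'k) big_matrix" where
  "juxtapose a = (\<chi> r c. a $ fst c $ r $ snd c)"

definition fanning_frame_jets :: "('n::finite, 'k::{finite,linorder}) frame_jet set" where
  "fanning_frame_jets = {a. invertible (juxtapose a)}"

definition GL_jets :: "(real^'n^'n, 'k::{finite,linorder}) vec set" where
  "GL_jets = {x. invertible (jet_entry x 0)}"

definition jet_mult ::
  "('n::finite, 'k::{finite,linorder}) frame_jet \<Rightarrow> (real^'n^'n, 'k) vec \<Rightarrow> ('n, 'k) frame_jet" where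
  "jet_mult a x =
     (\<chi> m. \<Sum>i\<le>pos m. real (pos m choose i) *\<^sub>R (jet_entry a (pos m - i) ** jet_entry x i))"

definition same_curve_jet :: "(('n::finite, 'k::{finite,linorder}) frame_jet \<times> ('n, 'k) frame_jet) set" where
  "same_curve_jet = {(a, jet_mult a x) | a x. a \<in> fanning_frame_jets \<and> x \<in> GL_jets}"

definition curve_jet :: "('n::finite, 'k::{finite,linorder}) frame_jet \<Rightarrow> ('n, 'k) frame_jet set" where
  "curve_jet a = same_curve_jet `` {a}"

definition fanning_curve_jets :: "('n::finite, 'k::{finite,linorder}) frame_jet set set" where
  "fanning_curve_jets = fanning_frame_jets // same_curve_jet"

definition fanning_curve_jet_manifold ::
  "('n::finite, 'k::{finite,linorder}) frame_jet set topology \<Rightarrow>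
   (('n, 'k) frame_jet set, 'e::euclidean_space) chart set \<Rightarrow> bool" where
  "fanning_curve_jet_manifold Y \<B> \<longleftrightarrow>
     quotient_manifold (top_of_set fanning_frame_jets) (open_set_atlas fanning_frame_jets)
       same_curve_jet Y \<B>"

definition frame_jet_act ::
  "('n::finite, 'k::{finite,linorder}) big_matrix \<Rightarrow> ('n, 'k) frame_jet \<Rightarrow> ('n, 'k) frame_jet" where
  "frame_jet_act T a = (\<chi> m. T ** (a $ m))"

text \<open>For invertible \<^term>\<open>T\<close> the union is over identical sets, so this is the class of \<^term>\<open>frame_jet_act T a\<close> for any
  representative \<^term>\<open>a\<close>.\<close>

definition curve_jet_act ::
  "('n::finite, 'k::{finite,linorder}) big_matrix \<Rightarrow> ('n, 'k) frame_jet set \<Rightarrow> ('n, 'k) frame_jet set" where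
  "curve_jet_act T c = (\<Union>a\<in>c. curve_jet (frame_jet_act T a))"

definition adjoint_act ::
  "('n::finite, 'k::{finite,linorder}) big_matrix \<Rightarrow> ('n, 'k) big_matrix \<Rightarrow> ('n, 'k) big_matrix" where
  "adjoint_act T M = T ** M ** matrix_inv T"

definition adjoint_orbit :: "('n::finite, 'k::{finite,linorder}) big_matrix \<Rightarrow> ('n, 'k) big_matrix set" where
  "adjoint_orbit M = {adjoint_act T M | T. invertible T}"

text \<open>The block superdiagonal matrix with blocks I, 2I, ..., (k-1)I: the block in block row
  i and block column i + 1 (counting from 0) is (i + 1) I.\<close>

definition block_nilpotent :: "('n::finite, 'k::{finite,linorder}) big_matrix" where
  "block_nilpotent =
     (\<chi> r c. if pos (fst c) = pos (fst r) + 1 \<and> snd r = snd c then real (pos (fst r) + 1) else 0)"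

definition frame_endomorphism ::
  "('n::finite, 'k::{finite,linorder}) frame_jet \<Rightarrow> ('n, 'k) big_matrix" where
  "frame_endomorphism a = juxtapose a ** block_nilpotent ** matrix_inv (juxtapose a)"

text \<open>The common value of \<^const>\<open>frame_endomorphism\<close> on all representatives of the jet.\<close>

definition fundamental_endomorphism ::
  "('n::finite, 'k::{finite,linorder}) frame_jet set \<Rightarrow> ('n, 'k) big_matrix" where
  "fundamental_endomorphism c = the_elem (frame_endomorphism ` c)"

end

theory Submission
  imports Defs
begin


text \<open>Write \<open>F a = A N A\<^sup>-\<^sup>1\<close> for a frame jet \<open>a\<close> with block matrix \<open>A\<close>, where \<open>N\<close> is the block nilpotent
  matrix. The equation \<open>M A = A N\<close> says that \<open>M\<close> lowers the entries of the jet,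
  \<open>M a\<^sub>j = j a\<^sub>j\<^sub>-\<^sub>1\<close>; such an \<open>a\<close> is called a ladder for \<open>M\<close> below. A ladder is determined by \<open>M\<close> and
  its last entry \<open>B\<close>, namely \<open>a\<^sub>j = (j! / (k-1)!) M\<^sup>k\<^sup>-\<^sup>1\<^sup>-\<^sup>j B\<close>, the jet \<open>ladder_from M B\<close>. Everything rests
  on this formula.

  Fibres. Multiplication by a jet of matrices preserves ladders for \<open>M\<close>, by the Leibniz rule, and can give
  the last entry any prescribed value. So two frame jets have the same \<open>F\<close> exactly if they differ by
  a jet of invertible matrices (\<open>same_curve_jet_iff\<close>): \<open>F\<close> is well defined and injective on jets of curves.
  Its image is the orbit of \<open>N\<close>, because the block matrices of fanning frames are all of \<open>GL(kn)\<close>, and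
  equivariance is immediate.

  Topology. For fixed \<open>B\<close> the map \<open>M \<mapsto> ladder_from M B\<close> is polynomial, and near \<open>F a\<close> it is a section of
  \<open>F\<close> over the orbit if \<open>B\<close> is the last entry of \<open>a\<close>. Hence \<open>F\<close> is a quotient map from frame jets onto
  the orbit, and it induces a homeomorphism from the jets of curves onto the orbit.

  Smooth structure. The frames with last entry \<open>B\<close> form an open subset of an affine space of
  dimension \<open>k(k-1)n\<^sup>2\<close> and meet every fibre at most once; the sections above turn them into charts of a
  quotient manifold (\<open>fanning_curve_jet_manifold_exists\<close>). For an arbitrary quotient manifold structure, let
  \<open>q\<close> be the projection followed by a chart and let \<open>g\<close> be the restriction of \<open>q\<close> to such a slice. Since \<open>q\<close> is a
  submersion which factors through \<open>g\<close>, and the dimensions agree, \<open>g\<close> has invertible derivative,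
  so its inverse is smooth and \<open>F\<close> is smooth in the chart. The map \<open>M \<mapsto> q (ladder_from M B)\<close> is a smooth
  left inverse of \<open>F\<close> in the chart, so \<open>F\<close> is an immersion
  (\<open>fundamental_endomorphism_smooth_embedding\<close>). Carrying the charts over to the image makes the orbit an
  embedded submanifold diffeomorphic to the space of jets (\<open>smooth_embedding_image\<close>).\<close>

section \<open>Calculus of \<open>C\<^sup>m\<close> maps\<close>

lemma Ck_on_cong:
  assumes "open S" "Ck_on m f S" "\<And>x. x \<in> S \<Longrightarrow> f x = g x"
  shows "Ck_on m g S"
  using assms(2,3)
proof (induction m arbitrary: f g)
  case 0
  then show ?case using continuous_on_cong[of S S f g] by simp
next
  case (Suc m)
  have der: "(g has_derivative frechet_derivative f (at x)) (at x)" if "x \<in> S" for x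
    using Suc.prems that assms(1)
    by (auto intro!: has_derivative_transform_within_open[of f _ x UNIV S g]
        simp: frechet_derivative_works)
  have "Ck_on m (\<lambda>x. frechet_derivative g (at x) v) S" for v
  proof (rule Suc.IH)
    show "Ck_on m (\<lambda>x. frechet_derivative f (at x) v) S"
      using Suc.prems(1) by simp
    show "frechet_derivative f (at x) v = frechet_derivative g (at x) v" if "x \<in> S" for x
      by (rule fun_cong[OF frechet_derivative_at[OF der[OF that]]])
  qed
  moreover have "g differentiable (at x)" if "x \<in> S" for x
    using der[OF that] by (rule differentiableI)
  ultimately show ?case by simp
qed

text \<open>The derivative need not be presented as \<open>frechet_derivative\<close>: any formula for it will do. The closure
  properties below feed the usual differentiation rules into this lemma.\<close>

lemma Ck_on_SucI:
  assumes "open S" "\<And>x. x \<in> S \<Longrightarrow> (f has_derivative f' x) (at x)"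
    and "\<And>v. Ck_on m (\<lambda>x. f' x v) S"
  shows "Ck_on (Suc m) f S"
proof -
  have "Ck_on m (\<lambda>x. frechet_derivative f (at x) v) S" for v
    by (rule Ck_on_cong[OF assms(1) assms(3)[of v]])
       (rule fun_cong[OF frechet_derivative_at[OF assms(2)]])
  moreover have "f differentiable (at x)" if "x \<in> S" for x
    using assms(2)[OF that] by (rule differentiableI)
  ultimately show ?thesis by simp
qed

lemma Ck_on_SucD:
  assumes "Ck_on (Suc m) f S"
  shows "x \<in> S \<Longrightarrow> (f has_derivative frechet_derivative f (at x)) (at x)"
    and "Ck_on m (\<lambda>x. frechet_derivative f (at x) v) S"
  using assms by (auto simp: frechet_derivative_works)

lemma Ck_on_Suc_imp: "Ck_on (Suc m) f S \<Longrightarrow> Ck_on m f S"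
proof (induction m arbitrary: f)
  case 0
  then show ?case
    by (auto intro!: continuous_at_imp_continuous_on dest: differentiable_imp_continuous_within)
next
  case (Suc m)
  have "Ck_on m (\<lambda>x. frechet_derivative f (at x) v) S" for v
    by (rule Suc.IH[OF Ck_on_SucD(2)[OF Suc.prems]])
  moreover have "f differentiable (at x)" if "x \<in> S" for x
    using Ck_on_SucD(1)[OF Suc.prems that] by (rule differentiableI)
  ultimately show ?case by simp
qed

lemma Ck_on_subset: "Ck_on m f S \<Longrightarrow> T \<subseteq> S \<Longrightarrow> Ck_on m f T"
  by (induction m arbitrary: f) (auto intro: continuous_on_subset)

lemma Ck_on_local:
  assumes "\<And>x. x \<in> S \<Longrightarrow> \<exists>W. open W \<and> x \<in> W \<and> Ck_on m f W"
  shows "Ck_on m f S"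
  using assms
proof (induction m arbitrary: f)
  case 0
  show ?case
    unfolding Ck_on.simps
  proof (rule continuous_at_imp_continuous_on, rule ballI)
    fix x assume "x \<in> S"
    then obtain W where "open W" "x \<in> W" "continuous_on W f"
      using 0[OF \<open>x \<in> S\<close>] by auto
    then show "isCont f x"
      using continuous_on_eq_continuous_at by blast
  qed
next
  case (Suc m)
  show ?case
    unfolding Ck_on.simps
  proof (intro conjI ballI allI)
    show "f differentiable at x" if "x \<in> S" for x
      using Suc.prems[OF that] Ck_on_SucD(1) differentiableI by metis
    show "Ck_on m (\<lambda>x. frechet_derivative f (at x) v) S" for v
    proof (rule Suc.IH)
      fix x assume "x \<in> S"
      then obtain W where "open W" "x \<in> W" "Ck_on (Suc m) f W"
        using Suc.prems by blast
      then show "\<exists>W. open W \<and> x \<in> W \<and> Ck_on m (\<lambda>x. frechet_derivative f (at x) v) W"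
        using Ck_on_SucD(2) by blast
    qed
  qed
qed

lemma Ck_on_const: "Ck_on m (\<lambda>x. c) S"
  by (induction m arbitrary: c) auto

lemma Ck_on_id: "Ck_on m (\<lambda>x. x) S"
  by (cases m) (auto simp: Ck_on_const)

lemma Ck_on_linear_comp:
  assumes "linear L" "open S" "Ck_on m f S"
  shows "Ck_on m (\<lambda>x. L (f x)) S"
  using assms(3)
proof (induction m arbitrary: f)
  case 0
  then show ?case
    using linear_continuous_on_compose[OF _ assms(1)] by auto
next
  case (Suc m)
  show ?case
    by (rule Ck_on_SucI[OF assms(2)
        bounded_linear.has_derivative[OF assms(1)[unfolded linear_conv_bounded_linear] Ck_on_SucD(1)[OF Suc.prems]]
        Suc.IH[OF Ck_on_SucD(2)[OF Suc.prems]]])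
qed

lemma Ck_on_linear: "linear L \<Longrightarrow> open S \<Longrightarrow> Ck_on m L S"
  using Ck_on_linear_comp[OF _ _ Ck_on_id] by blast

lemma Ck_on_add:
  assumes "open S" "Ck_on m f S" "Ck_on m g S"
  shows "Ck_on m (\<lambda>x. f x + g x) S"
  using assms(2,3)
proof (induction m arbitrary: f g)
  case 0
  then show ?case by (simp add: continuous_on_add)
next
  case (Suc m)
  show ?case
    by (rule Ck_on_SucI[OF assms(1)
        has_derivative_add[OF Ck_on_SucD(1)[OF Suc.prems(1)] Ck_on_SucD(1)[OF Suc.prems(2)]]
        Suc.IH[OF Ck_on_SucD(2)[OF Suc.prems(1)] Ck_on_SucD(2)[OF Suc.prems(2)]]])
qed

lemma Ck_on_sum:
  assumes "open S" "\<And>i. i \<in> I \<Longrightarrow> Ck_on m (f i) S"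
  shows "Ck_on m (\<lambda>x. \<Sum>i\<in>I. f i x) S"
  using assms(2) by (induction I rule: infinite_finite_induct) (auto simp: Ck_on_const Ck_on_add assms(1))

lemma Ck_on_vec_lambda:
  fixes f :: "'a::euclidean_space \<Rightarrow> 'i::finite \<Rightarrow> 'c::euclidean_space"
  assumes "open S" "\<And>i. Ck_on m (\<lambda>x. f x i) S"
  shows "Ck_on m (\<lambda>x. \<chi> i. f x i) S"
proof -
  have "(\<lambda>x. \<chi> i. f x i) = (\<lambda>x. \<Sum>i\<in>UNIV. axis i (f x i))"
    by (simp add: fun_eq_iff vec_eq_iff axis_def if_distrib cong: if_cong)
  moreover have "Ck_on m (\<lambda>x. \<Sum>i\<in>UNIV. axis i (f x i)) S"
  proof (rule Ck_on_sum[OF assms(1)])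
    have "linear (axis i :: 'c \<Rightarrow> 'c^'i)" for i
      by (intro linearI) (simp_all add: vec_eq_iff axis_def)
    then show "Ck_on m (\<lambda>x. axis i (f x i)) S" for i
      by (rule Ck_on_linear_comp[OF _ assms])
  qed
  ultimately show ?thesis by simp
qed

lemma Ck_on_bilinear:
  assumes "bounded_bilinear pr" "open S" "Ck_on m f S" "Ck_on m g S"
  shows "Ck_on m (\<lambda>x. pr (f x) (g x)) S"
  using assms(3,4)
proof (induction m arbitrary: f g)
  case 0
  then show ?case by (simp add: bounded_bilinear.continuous_on[OF assms(1)])
next
  case (Suc m)
  show ?case
  proof (rule Ck_on_SucI[OF assms(2)
        bounded_bilinear.FDERIV[OF assms(1) Ck_on_SucD(1)[OF Suc.prems(1)] Ck_on_SucD(1)[OF Suc.prems(2)]]])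
    show "Ck_on m (\<lambda>x. pr (f x) (frechet_derivative g (at x) v) + pr (frechet_derivative f (at x) v) (g x)) S" for v
      by (intro Ck_on_add assms Suc.IH) (simp_all add: Ck_on_Suc_imp[OF Suc.prems(1)] Ck_on_Suc_imp[OF Suc.prems(2)]
           Ck_on_SucD(2)[OF Suc.prems(1)] Ck_on_SucD(2)[OF Suc.prems(2)])
  qed
qed

lemma linear_basis_expansion:
  fixes L :: "'a::euclidean_space \<Rightarrow> 'b::real_vector"
  assumes "linear L"
  shows "L u = (\<Sum>b\<in>Basis. (u \<bullet> b) *\<^sub>R L b)"
proof -
  have "L u = L (\<Sum>b\<in>Basis. (u \<bullet> b) *\<^sub>R b)" by (simp only: euclidean_representation)
  then show ?thesis by (simp add: linear_sum[OF assms] linear_cmul[OF assms])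
qed

lemma Ck_on_compose:
  fixes f :: "'a::euclidean_space \<Rightarrow> 'b::euclidean_space" and g :: "'b \<Rightarrow> 'c::euclidean_space"
  assumes "open S" "Ck_on m f S" "Ck_on m g T" "f ` S \<subseteq> T"
  shows "Ck_on m (\<lambda>x. g (f x)) S"
  using assms(2-3)
proof (induction m arbitrary: g)
  case 0
  then show ?case using continuous_on_compose2 assms(4) by auto
next
  case (Suc m)
  note f = Ck_on_SucD[OF Suc.prems(1)] and g = Ck_on_SucD[OF Suc.prems(2)]
  \<comment> \<open>Only derivatives of \<open>g\<close> in a fixed direction are known to be \<open>C\<^sup>m\<close>, so the direction \<open>Df(x)v\<close>
    is expanded in the standard basis.\<close>
  let ?D = "\<lambda>x v. \<Sum>b\<in>Basis. (frechet_derivative f (at x) v \<bullet> b) *\<^sub>R frechet_derivative g (at (f x)) b"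
  show ?case
  proof (rule Ck_on_SucI[OF assms(1)])
    fix x assume x: "x \<in> S"
    have fx: "f x \<in> T" using x assms(4) by blast
    have "?D x v = frechet_derivative g (at (f x)) (frechet_derivative f (at x) v)" for v
      by (rule linear_basis_expansion[OF has_derivative_linear[OF g(1)[OF fx]], symmetric])
    moreover have "((\<lambda>x. g (f x)) has_derivative (\<lambda>v. frechet_derivative g (at (f x)) (frechet_derivative f (at x) v))) (at x)"
      by (rule has_derivative_compose[OF f(1)[OF x] g(1)[OF fx]])
    ultimately show "((\<lambda>x. g (f x)) has_derivative ?D x) (at x)" by simp
  next
    fix v
    show "Ck_on m (\<lambda>x. ?D x v) S"
      by (intro Ck_on_sum assms Ck_on_bilinear[OF bounded_bilinear_scaleR]
          Ck_on_linear_comp[of "\<lambda>w. w \<bullet> _"] f(2) Suc.IH g(2) Ck_on_Suc_imp[OF Suc.prems(1)])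
         (simp add: bounded_linear_inner_left bounded_linear.linear)
  qed
qed

text \<open>The product rule at a zero of \<open>f\<close>, where the scalar factor contributes only its value. Mere
  continuity of \<open>c\<close> suffices; this is what breaks the circle in differentiating inverse operators.\<close>

lemma has_derivative_scaleR_vanishing:
  fixes c :: "'a::real_normed_vector \<Rightarrow> real"
  assumes c: "continuous (at y) c" and f: "(f has_derivative f') (at y)" and "f y = 0"
  shows "((\<lambda>x. c x *\<^sub>R f x) has_derivative (\<lambda>v. c y *\<^sub>R f' v)) (at y)"
proof -
  have c': "(c \<longlongrightarrow> c y) (at y)"
    using c by (simp add: isCont_def)
  have q: "((\<lambda>x. norm (f x - f' (x - y)) / norm (x - y)) \<longlongrightarrow> 0) (at y)"
    using f assms(3) by (simp add: has_derivative_iff_norm)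
  from f have bl: "bounded_linear f'" by (rule has_derivative_bounded_linear)
  then obtain K where K: "\<And>v. norm (f' v) \<le> norm v * K"
    using bounded_linear.bounded by blast
  have lim: "((\<lambda>x. \<bar>c x\<bar> * (norm (f x - f' (x - y)) / norm (x - y)) + \<bar>c x - c y\<bar> * K) \<longlongrightarrow> \<bar>c y\<bar> * 0 + \<bar>c y - c y\<bar> * K) (at y)"
    by (intro tendsto_intros c' q)
  have bound: "norm (c x *\<^sub>R f x - c y *\<^sub>R f' (x - y)) / norm (x - y)
      \<le> \<bar>c x\<bar> * (norm (f x - f' (x - y)) / norm (x - y)) + \<bar>c x - c y\<bar> * K" if "x \<noteq> y" for x
  proof -
    have "c x *\<^sub>R f x - c y *\<^sub>R f' (x - y) = c x *\<^sub>R (f x - f' (x - y)) + (c x - c y) *\<^sub>R f' (x - y)"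
      by (simp add: algebra_simps)
    then have "norm (c x *\<^sub>R f x - c y *\<^sub>R f' (x - y))
        \<le> \<bar>c x\<bar> * norm (f x - f' (x - y)) + \<bar>c x - c y\<bar> * norm (f' (x - y))"
      by (metis norm_triangle_ineq norm_scaleR)
    also have "\<dots> \<le> \<bar>c x\<bar> * norm (f x - f' (x - y)) + \<bar>c x - c y\<bar> * (norm (x - y) * K)"
      by (intro add_left_mono mult_left_mono K) auto
    finally show ?thesis
      using that by (simp add: field_simps)
  qed
  have "((\<lambda>x. norm (c x *\<^sub>R f x - c y *\<^sub>R f' (x - y)) / norm (x - y)) \<longlongrightarrow> 0) (at y)"
    by (rule tendsto_sandwich[OF _ _ tendsto_const])
       (use bound lim in \<open>auto simp: eventually_at intro!: exI[of _ 1]\<close>)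
  then show ?thesis
    using bl assms(3) by (simp add: has_derivative_iff_norm bounded_linear_const_scaleR)
qed

text \<open>Near \<open>x\<close> the operators \<open>L y\<close> are bounded below by a uniform constant, so
  \<open>K y v - K x v = K y (v - L y (K x v))\<close> is controlled by \<open>v - L y (K x v)\<close>, which tends to \<open>0\<close>.\<close>

lemma continuous_on_operator_inverse:
  fixes L :: "'a::euclidean_space \<Rightarrow> 'b::euclidean_space \<Rightarrow> 'c::euclidean_space"
  assumes "open S" and L: "\<And>u. continuous_on S (\<lambda>y. L y u)"
    and lin: "\<And>y. y \<in> S \<Longrightarrow> linear (L y)" "\<And>y. y \<in> S \<Longrightarrow> linear (K y)"
    and inv: "\<And>y v. y \<in> S \<Longrightarrow> L y (K y v) = v" "\<And>y u. y \<in> S \<Longrightarrow> K y (L y u) = u"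
  shows "continuous_on S (\<lambda>y. K y v)"
proof (rule continuous_at_imp_continuous_on, rule ballI)
  fix x assume x: "x \<in> S"
  have L': "((\<lambda>y. L y u) \<longlongrightarrow> L x u) (at x)" for u
    using L[of u] x \<open>open S\<close> continuous_on_eq_continuous_at isCont_def by blast
  have S: "\<forall>\<^sub>F y in at x. y \<in> S"
    using x \<open>open S\<close> eventually_at_topological by blast
  obtain C where C: "C > 0" "\<And>v. norm (K x v) \<le> C * norm v"
    using linear_bounded_pos[OF lin(2)[OF x]] by blast
  \<comment> \<open>The operator norm of \<open>L y - L x\<close> is at most this sum, which tends to \<open>0\<close>.\<close>
  define \<epsilon> where "\<epsilon> y = (\<Sum>b\<in>Basis. norm (L y b - L x b))" for y
  have \<epsilon>: "norm (L y u - L x u) \<le> \<epsilon> y * norm u" if "y \<in> S" for y u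
  proof -
    have "L y u - L x u = (\<Sum>b\<in>Basis. (u \<bullet> b) *\<^sub>R (L y b - L x b))"
    proof -
      show ?thesis
        using linear_basis_expansion[OF lin(1)[OF that], of u] linear_basis_expansion[OF lin(1)[OF x], of u]
        by (simp add: sum_subtractf scaleR_diff_right)
    qed
    also have "norm \<dots> \<le> (\<Sum>b\<in>Basis. norm u * norm (L y b - L x b))"
      by (intro order_trans[OF norm_sum] sum_mono) (simp add: mult_right_mono Basis_le_norm)
    finally show ?thesis by (simp add: \<epsilon>_def sum_distrib_left mult.commute)
  qed
  have "(\<epsilon> \<longlongrightarrow> (\<Sum>b\<in>(Basis::'b set). norm (L x b - L x b))) (at x)"
    unfolding \<epsilon>_def by (intro tendsto_intros L')
  then have "\<forall>\<^sub>F y in at x. \<epsilon> y < 1 / (2 * C)"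
    using C(1) by (intro order_tendstoD(2)) auto
  with S have "\<forall>\<^sub>F y in at x. norm (K y v - K x v) \<le> 2 * C * norm (v - L y (K x v))"
  proof eventually_elim
    case (elim y)
    let ?u = "K y v - K x v"
    have Lu: "L y ?u = v - L y (K x v)"
      using elim by (simp add: inv linear_diff[OF lin(1)])
    have "norm ?u = norm (K x (L x ?u))" using inv x by simp
    also have "\<dots> \<le> C * norm (L x ?u)" by (rule C)
    also have "\<dots> \<le> C * (norm (L y ?u) + norm (L y ?u - L x ?u))"
      using C(1) norm_triangle_sub[of "L x ?u" "L y ?u"]
      by (intro mult_left_mono) (auto simp: norm_minus_commute)
    also have "\<dots> \<le> C * (norm (L y ?u) + 1 / (2 * C) * norm ?u)"
      using C(1) elim order_trans[OF \<epsilon>[of y ?u] mult_right_mono[of "\<epsilon> y" "1 / (2 * C)" "norm ?u"]]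
      by (intro mult_left_mono) auto
    finally show ?case
      using C(1) Lu by (simp add: field_simps)
  qed
  moreover have "((\<lambda>y. 2 * C * norm (v - L y (K x v))) \<longlongrightarrow> 2 * C * norm (v - L x (K x v))) (at x)"
    by (intro tendsto_intros L')
  ultimately have "((\<lambda>y. K y v - K x v) \<longlongrightarrow> 0) (at x)"
    using x by (auto simp: inv intro: Lim_null_comparison)
  then show "isCont (\<lambda>y. K y v) x"
    by (simp add: isCont_def LIM_zero_iff)
qed

text \<open>From \<open>K y v = K x v - K x ((L y - L x) (K y v))\<close>: expanding \<open>K y v\<close> in a basis writes the last term
  as a sum of products of continuous scalars with functions that vanish at \<open>x\<close>.\<close>

lemma has_derivative_operator_inverse:
  fixes L :: "'a::euclidean_space \<Rightarrow> 'b::euclidean_space \<Rightarrow> 'c::euclidean_space"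
  assumes "open S" "x \<in> S" and L: "\<And>u y. y \<in> S \<Longrightarrow> ((\<lambda>y. L y u) has_derivative L' y u) (at y)"
    and lin: "\<And>y. y \<in> S \<Longrightarrow> linear (L y)" "\<And>y. y \<in> S \<Longrightarrow> linear (K y)"
    and inv: "\<And>y v. y \<in> S \<Longrightarrow> L y (K y v) = v" "\<And>y u. y \<in> S \<Longrightarrow> K y (L y u) = u"
  shows "((\<lambda>y. K y v) has_derivative
     (\<lambda>w. - K x (\<Sum>b\<in>Basis. (K x v \<bullet> b) *\<^sub>R L' x b w))) (at x)"
proof -
  let ?r = "\<lambda>y. K x v - K x (\<Sum>b\<in>Basis. (K y v \<bullet> b) *\<^sub>R (L y b - L x b))"
  have "continuous_on S (\<lambda>y. K y v)"
  proof (rule continuous_on_operator_inverse[OF \<open>open S\<close> _ lin inv])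
    show "continuous_on S (\<lambda>y. L y u)" for u
      by (rule has_derivative_continuous_on[OF has_derivative_at_withinI[OF L]])
  qed
  then have cont: "isCont (\<lambda>y. K y v) x"
    using \<open>open S\<close> \<open>x \<in> S\<close> continuous_on_eq_continuous_at by blast
  have "((\<lambda>y. \<Sum>b\<in>Basis. (K y v \<bullet> b) *\<^sub>R (L y b - L x b)) has_derivative
      (\<lambda>w. \<Sum>b\<in>Basis. (K x v \<bullet> b) *\<^sub>R (L' x b w - 0))) (at x)"
    by (intro has_derivative_sum has_derivative_scaleR_vanishing has_derivative_diff has_derivative_const
        L \<open>x \<in> S\<close> continuous_intros cont) auto
  then have "(?r has_derivative (\<lambda>w. 0 - K x (\<Sum>b\<in>Basis. (K x v \<bullet> b) *\<^sub>R (L' x b w - 0)))) (at x)"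
    using lin(2)[OF \<open>x \<in> S\<close>]
    by (intro has_derivative_diff has_derivative_const bounded_linear.has_derivative[of "K x"])
       (auto simp: linear_conv_bounded_linear)
  moreover have "?r y = K y v" if y: "y \<in> S" for y
  proof -
    have "(\<Sum>b\<in>Basis. (K y v \<bullet> b) *\<^sub>R (L y b - L x b)) = L y (K y v) - L x (K y v)"
      using linear_basis_expansion[OF lin(1)[OF y], of "K y v"]
        linear_basis_expansion[OF lin(1)[OF \<open>x \<in> S\<close>], of "K y v"]
      by (simp add: sum_subtractf scaleR_diff_right)
    then show ?thesis
      using y \<open>x \<in> S\<close> by (simp add: inv linear_diff[OF lin(2)])
  qed
  ultimately show ?thesis
    using \<open>open S\<close> \<open>x \<in> S\<close> by (auto intro: has_derivative_transform_within_open[of ?r])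
qed

text \<open>The formula for the derivative of \<open>K y v\<close> involves only values \<open>K y w\<close> and derivatives of \<open>L\<close>, so
  smoothness bootstraps. The lemma serves both for matrix inversion and for the inverse function theorem.\<close>

lemma Ck_on_operator_inverse:
  fixes L :: "'a::euclidean_space \<Rightarrow> 'b::euclidean_space \<Rightarrow> 'c::euclidean_space"
  assumes "open S" and "\<And>u. Ck_on m (\<lambda>y. L y u) S"
    and lin: "\<And>y. y \<in> S \<Longrightarrow> linear (L y)" "\<And>y. y \<in> S \<Longrightarrow> linear (K y)"
    and inv: "\<And>y v. y \<in> S \<Longrightarrow> L y (K y v) = v" "\<And>y u. y \<in> S \<Longrightarrow> K y (L y u) = u"
  shows "Ck_on m (\<lambda>y. K y v) S"
  using assms(2)
proof (induction m arbitrary: v)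
  case 0
  show ?case
    unfolding Ck_on.simps
    by (rule continuous_on_operator_inverse[OF \<open>open S\<close> 0[unfolded Ck_on.simps] lin inv])
next
  case (Suc m)
  note L = Ck_on_SucD[OF Suc.prems]
  let ?z = "\<lambda>x w. \<Sum>b\<in>Basis. (K x v \<bullet> b) *\<^sub>R frechet_derivative (\<lambda>y. L y b) (at x) w"
  let ?D = "\<lambda>x w. - (\<Sum>c\<in>Basis. (?z x w \<bullet> c) *\<^sub>R K x c)"
  have IH: "Ck_on m (\<lambda>y. K y v) S" for v
    by (rule Suc.IH[OF Ck_on_Suc_imp[OF Suc.prems]])
  show ?case
  proof (rule Ck_on_SucI[OF \<open>open S\<close>])
    fix x assume x: "x \<in> S"
    have "(\<lambda>w. - K x (?z x w)) = ?D x"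
      by (intro ext arg_cong[where f=uminus] linear_basis_expansion lin(2)[OF x])
    moreover have "((\<lambda>y. K y v) has_derivative (\<lambda>w. - K x (?z x w))) (at x)"
      by (rule has_derivative_operator_inverse[OF \<open>open S\<close> x L(1) lin inv])
    ultimately show "((\<lambda>y. K y v) has_derivative ?D x) (at x)" by simp
  next
    fix w
    have inner: "linear (\<lambda>u. u \<bullet> b)" for b :: "'z::euclidean_space"
      by (simp add: bounded_linear_inner_left bounded_linear.linear)
    show "Ck_on m (\<lambda>x. ?D x w) S"
      by (intro Ck_on_linear_comp[of uminus] Ck_on_sum Ck_on_bilinear[OF bounded_bilinear_scaleR]
          Ck_on_linear_comp[OF inner] IH L(2) \<open>open S\<close>) (simp add: bounded_linear.linear bounded_linear_minus bounded_linear_ident)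
  qed
qed

text \<open>The smoothness part of the inverse function theorem: the derivative of \<open>h\<close> at \<open>y\<close> inverts that of \<open>g\<close>
  at \<open>h y\<close>, and it is as smooth as \<open>h\<close> itself by the previous lemma.\<close>

lemma Ck_on_inverse_function:
  fixes g :: "'a::euclidean_space \<Rightarrow> 'b::euclidean_space"
  assumes "open T" and g: "\<And>m. Ck_on m g S" and h: "continuous_on T h" "h ` T \<subseteq> S"
    and gh: "\<And>y. y \<in> T \<Longrightarrow> g (h y) = y"
    and bij: "\<And>y. y \<in> T \<Longrightarrow> bij (frechet_derivative g (at (h y)))"
  shows "Ck_on m h T"
proof (induction m)
  case 0
  then show ?case using h by simp
next
  case (Suc m)
  let ?L = "\<lambda>y. frechet_derivative g (at (h y))"
  let ?K = "\<lambda>y. inv (?L y)"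
  have der: "(g has_derivative ?L y) (at (h y))" if "y \<in> T" for y
    using Ck_on_SucD(1)[OF g] h(2) that by blast
  have linL: "linear (?L y)" if "y \<in> T" for y
    using der[OF that] by (rule has_derivative_linear)
  have linK: "linear (?K y)" if "y \<in> T" for y
  proof -
    note b = bij_is_inj[OF bij[OF that]] surj_f_inv_f[OF bij_is_surj[OF bij[OF that]]]
    show ?thesis
      by (rule linearI; rule inv_f_eq[OF b(1)]; simp add: b(2) linear_add[OF linL[OF that]] linear_cmul[OF linL[OF that]])
  qed
  show ?case
  proof (rule Ck_on_SucI[OF \<open>open T\<close>])
    fix y assume y: "y \<in> T"
    show "(h has_derivative ?K y) (at y)"
    proof (rule has_derivative_inverse_basic[OF der[OF y] _ _ _ \<open>open T\<close> y gh])
      show "bounded_linear (?K y)" using linK[OF y] by (simp add: linear_conv_bounded_linear)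
      show "?K y \<circ> ?L y = id" using bij[OF y] by (simp add: bij_is_inj)
      show "isCont h y" using h(1) \<open>open T\<close> y continuous_on_eq_continuous_at by blast
    qed
  next
    fix v
    show "Ck_on m (\<lambda>y. ?K y v) T"
    proof (rule Ck_on_operator_inverse[where L="?L", OF \<open>open T\<close> _ linL linK])
      show "Ck_on m (\<lambda>y. ?L y u) T" for u
        by (rule Ck_on_compose[OF \<open>open T\<close> Suc.IH Ck_on_SucD(2)[OF g] h(2)])
    qed (auto simp: bij bij_is_inj bij_is_surj surj_f_inv_f)
  qed
qed


section \<open>Matrices\<close>

lemma bilinear_matrix_matrix_mult:
  "bounded_bilinear ((**) :: real^'a::finite^'b::finite \<Rightarrow> real^'c::finite^'a \<Rightarrow> real^'c^'b)"
  unfolding bilinear_conv_bounded_bilinear[symmetric] bilinear_def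
  by (intro conjI allI linearI;
      simp add: vec_eq_iff matrix_matrix_mult_def algebra_simps sum.distrib sum_distrib_left)

interpretation matrix_mult: bounded_bilinear
  "(**) :: real^'a::finite^'b::finite \<Rightarrow> real^'c::finite^'a \<Rightarrow> real^'c^'b"
  by (rule bilinear_matrix_matrix_mult)

lemma matrix_inv_inverse:
  assumes "invertible A"
  shows "A ** matrix_inv A = mat 1" and "matrix_inv A ** A = mat 1"
  using someI_ex[OF assms[unfolded invertible_def]] unfolding matrix_inv_def by auto

lemma invertible_iff_inj:
  fixes A :: "real^'a::finite^'a"
  shows "invertible A \<longleftrightarrow> (\<forall>v. A *v v = 0 \<longrightarrow> v = 0)"
  by (simp add: invertible_left_inverse matrix_left_invertible_ker)

lemma open_invertible: "open {A :: real^'a::finite^'a. invertible A}"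
proof -
  have "continuous_on UNIV (det :: real^'a^'a \<Rightarrow> real)"
    unfolding det_def[abs_def] by (intro continuous_intros)
  then have "open (det -` (- {0}) :: (real^'a^'a) set)"
    by (intro open_vimage) auto
  then show ?thesis
    by (simp add: invertible_det_nz vimage_def Collect_neg_eq)
qed

lemma Ck_on_matrix_inv: "Ck_on m matrix_inv {A :: real^'a::finite^'a. invertible A}"
proof -
  let ?S = "{A :: real^'a^'a. invertible A}"
  have "Ck_on m (\<lambda>A. matrix_inv A ** mat 1) ?S"
  proof (rule Ck_on_operator_inverse[where L="(**)", OF open_invertible])
    show "Ck_on m (\<lambda>A. A ** X) ?S" for X :: "real^'a^'a"
      by (intro Ck_on_bilinear[OF bilinear_matrix_matrix_mult] open_invertible Ck_on_id Ck_on_const)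
    show "linear ((**) A)" "linear ((**) (matrix_inv A))" for A :: "real^'a^'a"
      by (simp_all add: matrix_mult.bounded_linear_right bounded_linear.linear)
  qed (simp_all add: matrix_mul_assoc matrix_inv_inverse)
  then show ?thesis by simp
qed

section \<open>The index type\<close>

lemma pos_strict_mono: "i < j \<Longrightarrow> pos i < pos (j :: 'k::{finite,linorder})"
  unfolding pos_def by (intro psubset_card_mono) auto

lemma inj_pos: "inj (pos :: 'k::{finite,linorder} \<Rightarrow> nat)"
  by (rule linorder_injI) (use pos_strict_mono in \<open>metis less_irrefl\<close>)

lemma pos_less_card: "pos (i :: 'k::{finite,linorder}) < CARD('k)"
  unfolding pos_def by (intro psubset_card_mono) auto

lemma range_pos: "range (pos :: 'k::{finite,linorder} \<Rightarrow> nat) = {..<CARD('k)}"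
  by (rule card_subset_eq) (auto simp: pos_less_card card_image inj_pos)

lemma bij_betw_pos: "bij_betw pos (UNIV :: 'k::{finite,linorder} set) {..<CARD('k)}"
  using inj_pos range_pos by (auto simp: bij_betw_def)

lemma obtain_pos:
  assumes "m < CARD('k::{finite,linorder})"
  obtains i :: "'k::{finite,linorder}" where "pos i = m"
  using assms range_pos[where 'k='k] by (metis imageE lessThan_iff)

lemma jet_entry_pos [simp]:
  fixes a :: "('a, 'k::{finite,linorder}) vec"
  shows "jet_entry a (pos i) = a $ i"
  by (simp add: jet_entry_def inj_pos)

lemma jet_entry_vec_lambda:
  assumes "m < CARD('k::{finite,linorder})"
  shows "jet_entry (\<chi> i::'k::{finite,linorder}. f (pos i)) m = f m"
  using assms by (metis jet_entry_pos obtain_pos vec_lambda_beta)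

lemma jet_eqI:
  fixes a b :: "('a, 'k::{finite,linorder}) vec"
  assumes "\<And>m. m < CARD('k) \<Longrightarrow> jet_entry a m = jet_entry b m"
  shows "a = b"
  using assms[OF pos_less_card] by (simp add: vec_eq_iff)

section \<open>Frames as block matrices\<close>

lemma linear_juxtapose: "linear juxtapose"
  by (rule linearI) (simp_all add: juxtapose_def vec_eq_iff)

lemma juxtapose_inject: "juxtapose a = juxtapose b \<longleftrightarrow> a = b"
  by (auto simp: juxtapose_def vec_eq_iff)

lemma juxtapose_surj:
  obtains a where "juxtapose a = T"
proof
  show "juxtapose (\<chi> c r p. T $ r $ (c, p)) = T"
    by (simp add: juxtapose_def vec_eq_iff)
qed

lemma juxtapose_act: "juxtapose (frame_jet_act T a) = T ** juxtapose a"
  by (simp add: juxtapose_def frame_jet_act_def matrix_matrix_mult_def vec_eq_iff)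

lemma juxtapose_mult_vec:
  "juxtapose a *v u = (\<Sum>j\<in>UNIV. a $ j *v (\<chi> p. u $ (j, p)))"
  by (simp add: vec_eq_iff matrix_vector_mult_def juxtapose_def sum.cartesian_product case_prod_unfold
      flip: UNIV_Times_UNIV)

lemma juxtapose_mult:
  "juxtapose a ** C = (\<Sum>j\<in>UNIV. a $ j ** (\<chi> p q. C $ (j, p) $ q))"
  by (simp add: vec_eq_iff matrix_matrix_mult_def juxtapose_def sum.cartesian_product case_prod_unfold
      flip: UNIV_Times_UNIV)

text \<open>Right multiplication by the nilpotent matrix acts on block columns: column \<open>j\<close> becomes \<open>j\<close> times
  column \<open>j - 1\<close>. For column \<open>0\<close> the index \<open>pos j - 1\<close> truncates to \<open>0\<close>, but the factor \<open>pos j\<close> vanishes.\<close>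

lemma juxtapose_mult_block_nilpotent:
  fixes a :: "('n::finite, 'k::{finite,linorder}) frame_jet"
  shows "juxtapose a ** block_nilpotent = juxtapose (\<chi> j. real (pos j) *\<^sub>R jet_entry a (pos j - 1))"
proof -
  have "(\<Sum>l\<in>UNIV. juxtapose a $ r $ l * block_nilpotent $ l $ (j, q))
      = real (pos j) * jet_entry a (pos j - 1) $ r $ q" for r j q
  proof (cases "pos j")
    case 0
    then show ?thesis by (simp add: block_nilpotent_def)
  next
    case (Suc m)
    then obtain i :: 'k where i: "pos i = m"
      using obtain_pos pos_less_card by (metis Suc_lessD)
    have "juxtapose a $ r $ l * block_nilpotent $ l $ (j, q) =
        (if l = (i, q) then real (pos j) * a $ i $ r $ q else 0)" for l
      by (cases l) (auto simp: block_nilpotent_def juxtapose_def Suc inj_eq[OF inj_pos] simp flip: i)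
    then show ?thesis
      using i by (simp add: Suc flip: i)
  qed
  then show ?thesis
    unfolding matrix_matrix_mult_def vec_eq_iff
    by (auto simp: juxtapose_def)
qed

section \<open>Ladders\<close>

text \<open>The matrix equation \<open>M A = A N\<close> read column by column, as \<open>ladder_iff\<close> shows.\<close>

definition ladder ::
  "('n::finite, 'k::{finite,linorder}) big_matrix \<Rightarrow> ('n, 'k) frame_jet \<Rightarrow> bool" where
  "ladder M a \<longleftrightarrow> (\<forall>m<CARD('k). M ** jet_entry a m = real m *\<^sub>R jet_entry a (m - 1))"

lemma ladder_iff: "ladder M a \<longleftrightarrow> M ** juxtapose a = juxtapose a ** block_nilpotent"
proof -
  have "ladder M a \<longleftrightarrow> (\<forall>j. M ** a $ j = real (pos j) *\<^sub>R jet_entry a (pos j - 1))"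
    unfolding ladder_def by (metis jet_entry_pos obtain_pos pos_less_card)
  then show ?thesis
    unfolding juxtapose_mult_block_nilpotent juxtapose_act[symmetric] juxtapose_inject
    by (simp add: frame_jet_act_def vec_lambda_inject fun_eq_iff)
qed

lemma frame_endomorphism_eq_iff:
  assumes "a \<in> fanning_frame_jets"
  shows "frame_endomorphism a = M \<longleftrightarrow> ladder M a"
proof -
  have "invertible (juxtapose a)" using assms by (simp add: fanning_frame_jets_def)
  note inv = matrix_inv_inverse[OF this]
  have "frame_endomorphism a ** juxtapose a = juxtapose a ** block_nilpotent"
    by (simp add: frame_endomorphism_def inv flip: matrix_mul_assoc)
  moreover have "M = juxtapose a ** block_nilpotent ** matrix_inv (juxtapose a)"
    if "M ** juxtapose a = juxtapose a ** block_nilpotent"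
    by (simp add: inv flip: that) (simp add: inv flip: matrix_mul_assoc)
  ultimately show ?thesis
    unfolding ladder_iff by (auto simp: frame_endomorphism_def)
qed

lemma ladder_frame_endomorphism: "a \<in> fanning_frame_jets \<Longrightarrow> ladder (frame_endomorphism a) a"
  using frame_endomorphism_eq_iff by blast

lemma funpow_mult_right:
  fixes M :: "real^'a::finite^'a" and X :: "real^'b::finite^'a" and C :: "real^'c::finite^'b"
  shows "((**) M ^^ d) (X ** C) = ((**) M ^^ d) X ** C"
  by (induction d) (simp_all add: matrix_mul_assoc)

lemma linear_funpow_mult: "linear ((**) M ^^ d :: real^'c::finite^'a::finite \<Rightarrow> real^'c^'a)"
proof (induction d)
  case 0
  show ?case by (simp add: linear_id[unfolded id_def] id_def)
next
  case (Suc d)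
  show ?case
    unfolding funpow.simps(2)
    by (rule linear_compose[OF Suc bounded_linear.linear[OF matrix_mult.bounded_linear_right]])
qed

lemma ladder_funpow:
  fixes a :: "('n::finite, 'k::{finite,linorder}) frame_jet"
  assumes "ladder M a" "m < CARD('k)"
  shows "((**) M ^^ d) (jet_entry a m) =
    (if d \<le> m then (fact m / fact (m - d)) *\<^sub>R jet_entry a (m - d) else 0)"
proof (induction d)
  case 0
  then show ?case by simp
next
  case (Suc d)
  consider "d < m" | "d = m" | "m < d" by linarith
  then show ?case
  proof cases
    case 1
    have "M ** jet_entry a (m - d) = real (m - d) *\<^sub>R jet_entry a (m - d - 1)"
      using assms unfolding ladder_def by (meson diff_le_self le_less_trans)
    moreover have "fact (m - d) = real (m - d) * fact (m - Suc d)"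
      using 1 by (subst fact_reduce) auto
    ultimately show ?thesis
      using 1 Suc by (simp add: matrix_mult.scaleR_right)
  next
    case 2
    have "M ** jet_entry a 0 = 0"
      using assms unfolding ladder_def by auto
    with 2 Suc show ?thesis by (simp add: matrix_mult.scaleR_right)
  next
    case 3
    with Suc show ?thesis by (simp add: matrix_mult.zero_right)
  qed
qed

text \<open>\<open>M\<^sup>k\<close> annihilates every entry of a ladder, and the columns of these entries span the whole space.\<close>

lemma ladder_nilpotent:
  fixes a :: "('n::finite, 'k::{finite,linorder}) frame_jet"
  assumes "ladder M a" "a \<in> fanning_frame_jets"
  shows "((**) M ^^ CARD('k)) B = (0 :: real^'c::finite^('k \<times> 'n))"
proof -
  have inv: "juxtapose a ** (matrix_inv (juxtapose a) ** B) = B"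
    using assms(2) by (simp add: matrix_mul_assoc matrix_inv_inverse fanning_frame_jets_def)
  have "((**) M ^^ CARD('k)) (a $ j) = 0" for j
    using ladder_funpow[OF assms(1) pos_less_card, of "CARD('k)" j] pos_less_card[of j] by simp
  then have "((**) M ^^ CARD('k)) (juxtapose a ** C) = 0" for C :: "real^'c^('k \<times> 'n)"
    by (simp add: juxtapose_mult linear_sum[OF linear_funpow_mult] funpow_mult_right matrix_mult.zero_left)
  then show ?thesis by (metis inv)
qed

text \<open>If a combination \<open>\<Sum> b\<^sub>j w\<^sub>j\<close> vanishes, applying \<open>M\<^sup>i\<close> for the largest \<open>i\<close> with \<open>w\<^sub>i \<noteq> 0\<close> leaves a nonzero multiple
  of \<open>b\<^sub>0 w\<^sub>i\<close>, which cannot vanish.\<close>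

lemma ladder_imp_fanning:
  fixes b :: "('n::finite, 'k::{finite,linorder}) frame_jet"
  assumes "ladder M b" and b0: "\<And>v. jet_entry b 0 *v v = 0 \<Longrightarrow> v = 0"
  shows "b \<in> fanning_frame_jets"
  unfolding fanning_frame_jets_def mem_Collect_eq invertible_iff_inj
proof (intro allI impI)
  fix u assume u: "juxtapose b *v u = 0"
  define w where "w j = (\<chi> p. u $ (j, p))" for j
  have "w j = 0" for j
  proof (rule ccontr)
    assume "w j \<noteq> 0"
    define i where "i = Max {j. w j \<noteq> 0}"
    have wi: "w i \<noteq> 0" and max: "\<And>l. i < l \<Longrightarrow> w l = 0"
      using Max_in[of "{j. w j \<noteq> 0}"] Max_ge[of "{j. w j \<noteq> 0}"] \<open>w j \<noteq> 0\<close>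
      by (auto simp: i_def) (metis (mono_tags) Max_ge finite_code linorder_not_le mem_Collect_eq)
    \<comment> \<open>\<open>M\<^sup>i\<close> kills the blocks before \<open>i\<close> and carries block \<open>i\<close> to a multiple of block \<open>0\<close>.\<close>
    have summand: "((**) M ^^ pos i) (b $ l) *v w l = (if l = i then fact (pos i) *\<^sub>R (jet_entry b 0 *v w i) else 0)" for l
    proof -
      consider "l < i" | "l = i" | "i < l" by fastforce
      then show ?thesis
        using ladder_funpow[OF assms(1) pos_less_card, of "pos i" l] pos_strict_mono[of l i] max[of l]
        by cases (auto simp: scaleR_matrix_vector_assoc)
    qed
    have "(\<Sum>l\<in>UNIV. ((**) M ^^ d) (b $ l) *v w l) = 0" for d
    proof (induction d)
      case 0
      then show ?case using u by (simp add: juxtapose_mult_vec w_def)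
    next
      case (Suc d)
      have "(\<Sum>l\<in>UNIV. ((**) M ^^ Suc d) (b $ l) *v w l) = M *v (\<Sum>l\<in>UNIV. ((**) M ^^ d) (b $ l) *v w l)"
        by (simp add: linear_sum[OF matrix_vector_mul_linear] matrix_vector_mul_assoc)
      with Suc show ?case by simp
    qed
    from this[of "pos i"] have "jet_entry b 0 *v w i = 0"
      unfolding summand by (simp add: sum.delta)
    with b0 wi show False by blast
  qed
  then show "u = 0" by (simp add: w_def vec_eq_iff)
qed

text \<open>The only candidate for a ladder for \<open>M\<close> with last entry \<open>B\<close>, found by descending from \<open>B\<close>. It is
  polynomial in \<open>M\<close> and defined for all \<open>M\<close>, which is what makes it useful as a local section.\<close>

definition ladder_from ::
  "('n::finite, 'k::{finite,linorder}) big_matrix \<Rightarrow> real^'n^('k \<times> 'n) \<Rightarrow> ('n, 'k) frame_jet" where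
  "ladder_from M B =
     (\<chi> j. (fact (pos j) / fact (CARD('k) - 1)) *\<^sub>R ((**) M ^^ (CARD('k) - 1 - pos j)) B)"

definition last_entry :: "('a, 'k::{finite,linorder}) vec \<Rightarrow> 'a" where
  "last_entry a = jet_entry a (CARD('k) - 1)"

lemma last_index: "CARD('k::finite) - 1 < CARD('k)"
  using zero_less_card_finite[where 'a='k] by linarith

lemma jet_entry_ladder_from:
  fixes M :: "('n::finite, 'k::{finite,linorder}) big_matrix"
  shows "m < CARD('k) \<Longrightarrow> jet_entry (ladder_from M B) m =
    (fact m / fact (CARD('k) - 1)) *\<^sub>R ((**) M ^^ (CARD('k) - 1 - m)) B"
  unfolding ladder_from_def
  by (rule jet_entry_vec_lambda[where f="\<lambda>m. (fact m / fact (CARD('k) - 1)) *\<^sub>R ((**) M ^^ (CARD('k) - 1 - m)) B"])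

lemma last_entry_ladder_from: "last_entry (ladder_from M B) = B"
  using jet_entry_ladder_from[OF last_index] by (simp add: last_entry_def)

lemma ladder_eq_ladder_from:
  fixes a :: "('n::finite, 'k::{finite,linorder}) frame_jet"
  assumes "ladder M a"
  shows "a = ladder_from M (last_entry a)"
proof (rule jet_eqI)
  fix m assume m: "m < CARD('k)"
  then have "CARD('k) - 1 - (CARD('k) - 1 - m) = m" by linarith
  then show "jet_entry a m = jet_entry (ladder_from M (last_entry a)) m"
    using ladder_funpow[OF assms last_index, of "CARD('k) - 1 - m"]
    by (simp add: jet_entry_ladder_from[OF m] last_entry_def)
qed

lemma ladder_ladder_from:
  fixes M :: "('n::finite, 'k::{finite,linorder}) big_matrix"
  assumes "((**) M ^^ CARD('k)) B = 0"
  shows "ladder M (ladder_from M B)"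
  unfolding ladder_def
proof (intro allI impI)
  fix m assume m: "m < CARD('k)"
  show "M ** jet_entry (ladder_from M B) m = real m *\<^sub>R jet_entry (ladder_from M B) (m - 1)"
  proof (cases m)
    case 0
    have "Suc (CARD('k) - 1) = CARD('k)" using m by linarith
    then have "((**) M ^^ Suc (CARD('k) - 1)) B = 0" by (simp only: assms)
    then have "M ** ((**) M ^^ (CARD('k) - 1)) B = 0" by (simp only: funpow.simps(2) comp_apply)
    then show ?thesis
      unfolding 0 using m by (simp add: jet_entry_ladder_from matrix_mult.scaleR_right)
  next
    case (Suc l)
    then have "CARD('k) - 1 - l = Suc (CARD('k) - 1 - m)" using m by linarith
    with Suc m show ?thesis
      by (simp add: jet_entry_ladder_from matrix_mult.scaleR_right)
  qed
qed

lemma jet_entry_jet_mult: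
  fixes a :: "('n::finite, 'k::{finite,linorder}) frame_jet"
  shows "m < CARD('k) \<Longrightarrow> jet_entry (jet_mult a x) m =
    (\<Sum>i\<le>m. real (m choose i) *\<^sub>R (jet_entry a (m - i) ** jet_entry x i))"
  unfolding jet_mult_def
  by (rule jet_entry_vec_lambda[where f="\<lambda>m. \<Sum>i\<le>m. real (m choose i) *\<^sub>R (jet_entry a (m - i) ** jet_entry x i)"])

text \<open>The Leibniz rule. After \<open>M\<close> lowers \<open>a\<^sub>m\<^sub>-\<^sub>i\<close>, the factor \<open>m - i\<close> is absorbed by
  \<open>(m - i) (m choose i) = m (m - 1 choose i)\<close>.\<close>

lemma ladder_jet_mult:
  assumes "ladder M (a :: ('n::finite, 'k::{finite,linorder}) frame_jet)"
  shows "ladder M (jet_mult a x)"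
  unfolding ladder_def
proof (intro allI impI)
  fix m assume m: "m < CARD('k)"
  have M: "M ** jet_entry a (m - i) = real (m - i) *\<^sub>R jet_entry a (m - i - 1)" for i
    using assms m unfolding ladder_def by (meson diff_le_self le_less_trans)
  have "M ** jet_entry (jet_mult a x) m =
      (\<Sum>i\<le>m. (real (m choose i) * real (m - i)) *\<^sub>R (jet_entry a (m - i - 1) ** jet_entry x i))"
    by (simp add: jet_entry_jet_mult[OF m] matrix_mult.sum_right matrix_mult.scaleR_right
        matrix_mul_assoc M matrix_mult.scaleR_left)
  also have "\<dots> = real m *\<^sub>R jet_entry (jet_mult a x) (m - 1)"
  proof (cases m)
    case 0
    then show ?thesis by simp
  next
    case (Suc l)
    have "real (m choose i) * real (m - i) = real m * real (l choose i)" for i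
      using binomial_absorb_comp[of m i] Suc by (metis diff_Suc_1 mult.commute of_nat_mult)
    note coeff = this
    have "(\<Sum>i\<le>m. (real (m choose i) * real (m - i)) *\<^sub>R (jet_entry a (m - i - 1) ** jet_entry x i))
        = (\<Sum>i\<le>m. (real m * real (l choose i)) *\<^sub>R (jet_entry a (l - i) ** jet_entry x i))"
      by (intro sum.cong refl arg_cong2[where f=scaleR] coeff) (simp add: Suc)
    then show ?thesis
      using Suc m by (simp add: jet_entry_jet_mult scaleR_sum_right)
  qed
  finally show "M ** jet_entry (jet_mult a x) m = real m *\<^sub>R jet_entry (jet_mult a x) (m - 1)" .
qed

lemma fanning_entry_inj:
  assumes a: "a \<in> fanning_frame_jets" and v: "a $ i *v v = 0"
  shows "v = 0"
proof -
  define u where "u = (\<chi> l. if fst l = i then v $ snd l else 0)"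
  have "(\<Sum>j\<in>UNIV. a $ j *v (\<chi> p. u $ (j, p))) = (\<Sum>j\<in>UNIV. if j = i then a $ i *v v else 0)"
    by (intro sum.cong) (auto simp: u_def vec_eq_iff matrix_vector_mult_def)
  then have "juxtapose a *v u = 0"
    using v by (simp add: juxtapose_mult_vec)
  then have "u = 0"
    using a by (simp add: fanning_frame_jets_def invertible_iff_inj)
  then have "u $ (i, p) = 0" for p
    by simp
  then show ?thesis by (simp add: u_def vec_eq_iff)
qed

text \<open>The last entry of \<open>jet_mult a x\<close> is \<open>\<Sum> (k-1 choose i) a\<^sub>k\<^sub>-\<^sub>1\<^sub>-\<^sub>i x\<^sub>i\<close>, and every matrix \<open>B\<close> is a combination
  \<open>A C\<close> of the entries of \<open>a\<close>; so \<open>x\<^sub>i\<close> is the block \<open>k-1-i\<close> of \<open>C\<close> up to the binomial factor.\<close>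

lemma jet_mult_last_entry_surj:
  fixes a :: "('n::finite, 'k::{finite,linorder}) frame_jet"
  assumes "a \<in> fanning_frame_jets"
  obtains x where "last_entry (jet_mult a x) = B"
proof -
  let ?K = "CARD('k) - 1"
  define C where "C = matrix_inv (juxtapose a) ** B"
  define c :: "(real^'n^'n, 'k) vec" where "c = (\<chi> j p q. C $ (j, p) $ q)"
  define x :: "(real^'n^'n, 'k) vec" where
    "x = (\<chi> i. (1 / real (?K choose pos i)) *\<^sub>R jet_entry c (?K - pos i))"
  have x: "jet_entry x i = (1 / real (?K choose i)) *\<^sub>R jet_entry c (?K - i)" if "i \<le> ?K" for i
    unfolding x_def
    by (rule jet_entry_vec_lambda[OF le_less_trans[OF that last_index],
          where f="\<lambda>i. (1 / real (?K choose i)) *\<^sub>R jet_entry c (?K - i)"])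
  have "last_entry (jet_mult a x) = (\<Sum>i\<le>?K. jet_entry a (?K - i) ** jet_entry c (?K - i))"
    unfolding last_entry_def jet_entry_jet_mult[OF last_index]
    by (intro sum.cong refl) (simp add: x matrix_mult.scaleR_right)
  also have "\<dots> = (\<Sum>i\<le>?K. jet_entry a i ** jet_entry c i)"
    by (rule sum.reindex_bij_witness[of _ "\<lambda>i. ?K - i" "\<lambda>i. ?K - i"]) auto
  also have "{..?K} = {..<CARD('k)}"
    by (metis Suc_pred lessThan_Suc_atMost zero_less_card_finite diff_Suc_1 One_nat_def)
  also have "(\<Sum>i<CARD('k). jet_entry a i ** jet_entry c i) = (\<Sum>j\<in>UNIV. a $ j ** c $ j)"
    using sum.reindex_bij_betw[OF bij_betw_pos[where 'k='k], of "\<lambda>i. jet_entry a i ** jet_entry c i"]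
    by simp
  also have "\<dots> = juxtapose a ** C"
    by (simp add: juxtapose_mult c_def)
  also have "\<dots> = B"
    using assms by (simp add: C_def matrix_mul_assoc matrix_inv_inverse fanning_frame_jets_def)
  finally show ?thesis by (rule that)
qed

lemma jet_entry_jet_mult_0: "jet_entry (jet_mult a x) 0 = jet_entry a 0 ** jet_entry x 0"
  by (simp add: jet_entry_jet_mult)

text \<open>For the converse direction, pick \<open>x\<close> such that \<open>jet_mult a x\<close> and \<open>b\<close> have the same last entry. Both are
  ladders for the same matrix, hence equal; in degree \<open>0\<close> this reads \<open>b\<^sub>0 = a\<^sub>0 x\<^sub>0\<close>, so \<open>x\<^sub>0\<close> is injective.\<close>

lemma same_curve_jet_iff:
  "(a, b) \<in> same_curve_jet \<longleftrightarrow>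
     a \<in> fanning_frame_jets \<and> b \<in> fanning_frame_jets \<and> frame_endomorphism a = frame_endomorphism b"
  (is "?L \<longleftrightarrow> ?R")
proof
  assume ?L
  then obtain x where a: "a \<in> fanning_frame_jets" and x: "x \<in> GL_jets" and b: "b = jet_mult a x"
    by (auto simp: same_curve_jet_def)
  have l: "ladder (frame_endomorphism a) b"
    unfolding b by (rule ladder_jet_mult[OF ladder_frame_endomorphism[OF a]])
  moreover have "v = 0" if "jet_entry b 0 *v v = 0" for v
  proof -
    have "jet_entry a 0 *v (jet_entry x 0 *v v) = 0"
      using that by (simp add: b jet_entry_jet_mult_0 matrix_vector_mul_assoc)
    then have "jet_entry x 0 *v v = 0"
      using fanning_entry_inj[OF a] unfolding jet_entry_def by blast
    then show ?thesis
      using x by (simp add: GL_jets_def invertible_iff_inj)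
  qed
  ultimately have "b \<in> fanning_frame_jets" by (rule ladder_imp_fanning)
  with a l show ?R using frame_endomorphism_eq_iff by metis
next
  assume ?R
  then have a: "a \<in> fanning_frame_jets" and b: "b \<in> fanning_frame_jets"
    and l: "ladder (frame_endomorphism a) a" "ladder (frame_endomorphism a) b"
    using ladder_frame_endomorphism by metis+
  obtain x where x: "last_entry (jet_mult a x) = last_entry b"
    using jet_mult_last_entry_surj[OF a] by blast
  have eq: "b = jet_mult a x"
    using ladder_eq_ladder_from[OF l(2)] ladder_eq_ladder_from[OF ladder_jet_mult[OF l(1), of x]] x
    by simp
  have "v = 0" if "jet_entry x 0 *v v = 0" for v
  proof (rule fanning_entry_inj[OF b])
    have "jet_entry b 0 *v v = 0"
      using that by (simp add: eq jet_entry_jet_mult_0 flip: matrix_vector_mul_assoc)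
    then show "b $ inv pos 0 *v v = 0"
      by (simp add: jet_entry_def)
  qed
  then have "x \<in> GL_jets" by (simp add: GL_jets_def invertible_iff_inj)
  with a eq show ?L by (auto simp: same_curve_jet_def)
qed


section \<open>Jets of fanning curves\<close>

lemma fanning_curve_jets_eq: "fanning_curve_jets = curve_jet ` fanning_frame_jets"
  by (auto simp: fanning_curve_jets_def quotient_def curve_jet_def)

lemma curve_jet_eq:
  "a \<in> fanning_frame_jets \<Longrightarrow>
    curve_jet a = {b \<in> fanning_frame_jets. frame_endomorphism b = frame_endomorphism a}"
  unfolding curve_jet_def by (auto simp: same_curve_jet_iff)

lemma fundamental_endomorphism_curve_jet:
  assumes "a \<in> fanning_frame_jets"
  shows "fundamental_endomorphism (curve_jet a) = frame_endomorphism a"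
proof -
  have "frame_endomorphism ` curve_jet a = {frame_endomorphism a}"
    unfolding curve_jet_eq[OF assms] using assms by auto
  then show ?thesis by (simp add: fundamental_endomorphism_def)
qed

lemma inj_on_fundamental_endomorphism: "inj_on fundamental_endomorphism fanning_curve_jets"
proof (rule inj_onI)
  fix c d assume "c \<in> fanning_curve_jets" "d \<in> fanning_curve_jets"
    and eq: "fundamental_endomorphism c = fundamental_endomorphism d"
  then obtain a b where "a \<in> fanning_frame_jets" "b \<in> fanning_frame_jets" "c = curve_jet a" "d = curve_jet b"
    by (auto simp: fanning_curve_jets_eq)
  with eq show "c = d"
    by (simp add: fundamental_endomorphism_curve_jet) (simp add: curve_jet_eq)
qed

lemma fundamental_endomorphism_image:
  "fundamental_endomorphism ` fanning_curve_jets = frame_endomorphism ` fanning_frame_jets"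
  unfolding fanning_curve_jets_eq image_image
  by (intro image_cong refl fundamental_endomorphism_curve_jet)

text \<open>Every invertible matrix is the block matrix of a fanning frame jet.\<close>

lemma frame_endomorphism_image:
  "frame_endomorphism ` (fanning_frame_jets :: ('n::finite, 'k::{finite,linorder}) frame_jet set) =
    adjoint_orbit block_nilpotent"
proof -
  have "juxtapose ` (fanning_frame_jets :: ('n, 'k) frame_jet set) = {T. invertible T}"
    unfolding fanning_frame_jets_def by (auto simp: image_iff) (metis juxtapose_surj)
  then have "adjoint_orbit block_nilpotent =
      (\<lambda>T. adjoint_act T block_nilpotent) ` juxtapose ` (fanning_frame_jets :: ('n, 'k) frame_jet set)"
    by (auto simp: adjoint_orbit_def)
  then show ?thesis
    by (simp add: image_image adjoint_act_def frame_endomorphism_def[abs_def])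
qed

lemma frame_endomorphism_act:
  assumes T: "invertible T" and a: "a \<in> fanning_frame_jets"
  shows "frame_jet_act T a \<in> fanning_frame_jets"
    and "frame_endomorphism (frame_jet_act T a) = adjoint_act T (frame_endomorphism a)"
proof -
  have inv: "invertible (juxtapose a)" using a by (simp add: fanning_frame_jets_def)
  show *: "frame_jet_act T a \<in> fanning_frame_jets"
    using invertible_mult[OF T inv] by (simp add: fanning_frame_jets_def juxtapose_act)
  have "ladder (adjoint_act T (frame_endomorphism a)) (frame_jet_act T a)"
  proof -
    have "adjoint_act T (frame_endomorphism a) ** (T ** juxtapose a)
        = T ** frame_endomorphism a ** (matrix_inv T ** T) ** juxtapose a"
      by (simp only: adjoint_act_def matrix_mul_assoc)
    also have "\<dots> = T ** (frame_endomorphism a ** juxtapose a)"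
      by (simp only: matrix_inv_inverse[OF T] matrix_mul_rid matrix_mul_assoc)
    also have "\<dots> = T ** juxtapose a ** block_nilpotent"
      using ladder_frame_endomorphism[OF a] by (simp only: ladder_iff matrix_mul_assoc)
    finally show ?thesis by (simp only: ladder_iff juxtapose_act)
  qed
  then show "frame_endomorphism (frame_jet_act T a) = adjoint_act T (frame_endomorphism a)"
    using frame_endomorphism_eq_iff[OF *] by blast
qed

lemma fundamental_endomorphism_equivariant:
  assumes T: "invertible T" and "c \<in> fanning_curve_jets"
  shows "fundamental_endomorphism (curve_jet_act T c) = adjoint_act T (fundamental_endomorphism c)"
proof -
  obtain a where a: "a \<in> fanning_frame_jets" and c: "c = curve_jet a"
    using assms(2) by (auto simp: fanning_curve_jets_eq)
  have "curve_jet (frame_jet_act T b) = curve_jet (frame_jet_act T a)" if "b \<in> c" for b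
    using that unfolding c curve_jet_eq[OF a]
    by (simp add: curve_jet_eq frame_endomorphism_act[OF T] a)
  moreover have "a \<in> c"
    by (simp add: c curve_jet_eq[OF a] a)
  ultimately have "curve_jet_act T c = curve_jet (frame_jet_act T a)"
    unfolding curve_jet_act_def by blast
  then show ?thesis
    by (simp add: c fundamental_endomorphism_curve_jet frame_endomorphism_act[OF T] a)
qed

section \<open>Local sections\<close>

lemma open_fanning_frame_jets: "open (fanning_frame_jets :: ('n::finite, 'k::{finite,linorder}) frame_jet set)"
proof -
  have "continuous_on UNIV (juxtapose :: ('n, 'k) frame_jet \<Rightarrow> _)"
    by (rule linear_continuous_on) (use linear_juxtapose in \<open>simp only: linear_conv_bounded_linear\<close>)
  then have "open (juxtapose -` {A. invertible A} :: ('n, 'k) frame_jet set)"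
    by (intro open_vimage open_invertible)
  then show ?thesis by (simp add: fanning_frame_jets_def vimage_def)
qed

lemma Ck_on_frame_endomorphism:
  "Ck_on m frame_endomorphism (fanning_frame_jets :: ('n::finite, 'k::{finite,linorder}) frame_jet set)"
proof -
  have j: "Ck_on m juxtapose (fanning_frame_jets :: ('n, 'k) frame_jet set)"
    by (rule Ck_on_linear[OF linear_juxtapose open_fanning_frame_jets])
  have "Ck_on m (\<lambda>a. matrix_inv (juxtapose a)) (fanning_frame_jets :: ('n, 'k) frame_jet set)"
    by (rule Ck_on_compose[OF open_fanning_frame_jets j Ck_on_matrix_inv])
       (auto simp: fanning_frame_jets_def)
  then show ?thesis
    unfolding frame_endomorphism_def[abs_def]
    by (intro Ck_on_bilinear[OF bilinear_matrix_matrix_mult] j open_fanning_frame_jets Ck_on_const)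
qed

lemma continuous_on_frame_endomorphism: "continuous_on fanning_frame_jets frame_endomorphism"
  using Ck_on_frame_endomorphism[of 0] by simp

lemma Ck_on_ladder_from:
  fixes B :: "real^'n^('k::{finite,linorder} \<times> 'n::finite)"
  shows "Ck_on m (\<lambda>M :: ('n::finite, 'k::{finite,linorder}) big_matrix. ladder_from M B) UNIV"
proof -
  have "Ck_on m (\<lambda>M :: ('n, 'k) big_matrix. ((**) M ^^ d) B) UNIV" for d
  proof (induction d)
    case 0
    then show ?case by (simp add: Ck_on_const)
  next
    case (Suc d)
    then show ?case
      using Ck_on_bilinear[OF bilinear_matrix_matrix_mult open_UNIV Ck_on_id Suc] by simp
  qed
  then show ?thesis
    unfolding ladder_from_def
    by (intro Ck_on_vec_lambda Ck_on_bilinear[OF bounded_bilinear_scaleR] Ck_on_const open_UNIV)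
qed

lemma continuous_on_ladder_from: "continuous_on S (\<lambda>M. ladder_from M B)"
  using Ck_on_subset[OF Ck_on_ladder_from[of 0], of S B] by simp

text \<open>The section property. \<open>M\<close> must lie on the orbit: there \<open>M\<^sup>k = 0\<close>, which is the lowest step
  \<open>M a\<^sub>0 = 0\<close> of the ladder.\<close>

lemma frame_endomorphism_ladder_from:
  assumes "ladder_from M B \<in> fanning_frame_jets" "M \<in> frame_endomorphism ` fanning_frame_jets"
  shows "frame_endomorphism (ladder_from M B) = M"
proof -
  obtain a where a: "a \<in> fanning_frame_jets" "M = frame_endomorphism a"
    using assms(2) by blast
  have "ladder M (ladder_from M B)"
    using ladder_nilpotent[OF ladder_frame_endomorphism[OF a(1)] a(1)] a(2)
    by (intro ladder_ladder_from) simp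
  then show ?thesis
    using frame_endomorphism_eq_iff[OF assms(1)] by blast
qed

lemma ladder_from_frame_endomorphism:
  "a \<in> fanning_frame_jets \<Longrightarrow> ladder_from (frame_endomorphism a) (last_entry a) = a"
  using ladder_eq_ladder_from[OF ladder_frame_endomorphism] by metis

lemma quotient_map_by_local_sections:
  assumes f: "continuous_map X Z f" "f ` topspace X = topspace Z"
    and loc: "\<And>z. z \<in> topspace Z \<Longrightarrow> \<exists>W s. openin Z W \<and> z \<in> W \<and>
        continuous_map (subtopology Z W) X s \<and> (\<forall>w\<in>W. f (s w) = w)"
  shows "quotient_map X Z f"
  unfolding quotient_map_def
proof (intro conjI allI impI)
  fix U assume U: "U \<subseteq> topspace Z"
  show "openin X {x \<in> topspace X. f x \<in> U} = openin Z U"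
  proof
    assume P: "openin X {x \<in> topspace X. f x \<in> U}"
    show "openin Z U"
    proof (subst openin_subopen, intro ballI)
      fix z assume "z \<in> U"
      with U have "z \<in> topspace Z" by blast
      from loc[OF this] obtain W s where W: "openin Z W" "z \<in> W" "continuous_map (subtopology Z W) X s"
        and s: "\<forall>w\<in>W. f (s w) = w"
        by (elim exE conjE)
      let ?P = "{w \<in> topspace (subtopology Z W). s w \<in> {x \<in> topspace X. f x \<in> U}}"
      have "openin Z ?P"
        by (rule openin_trans_full[OF openin_continuous_map_preimage[OF W(3) P] W(1)])
      moreover have "?P = W \<inter> U"
        using s continuous_map_funspace[OF W(3)] openin_subset[OF W(1)] by (auto simp: Pi_iff)
      ultimately have "openin Z (W \<inter> U)" by simp
      then show "\<exists>T. openin Z T \<and> z \<in> T \<and> T \<subseteq> U"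
        using \<open>z \<in> U\<close> W(2) by (intro exI[of _ "W \<inter> U"]) simp
    qed
  qed (rule openin_continuous_map_preimage[OF f(1)])
qed (rule f(2))

lemma quotient_map_frame_endomorphism:
  "quotient_map (top_of_set fanning_frame_jets) (top_of_set (frame_endomorphism ` fanning_frame_jets))
    (frame_endomorphism :: ('n::finite, 'k::{finite,linorder}) frame_jet \<Rightarrow> _)"
    (is "quotient_map ?X ?Z ?f")
proof (rule quotient_map_by_local_sections)
  show "continuous_map ?X ?Z ?f"
    using continuous_on_frame_endomorphism by (simp add: continuous_map_in_subtopology)
  fix M assume "M \<in> topspace ?Z"
  then obtain a where a: "a \<in> fanning_frame_jets" "M = frame_endomorphism a" by auto
  let ?s = "\<lambda>M. ladder_from M (last_entry a)"
  let ?W = "?f ` fanning_frame_jets \<inter> ?s -` fanning_frame_jets"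
  have "openin ?Z ?W"
    by (intro openin_open_Int open_vimage open_fanning_frame_jets continuous_on_ladder_from)
  moreover have "M \<in> ?W"
    using a by (simp add: ladder_from_frame_endomorphism)
  moreover have "continuous_map (subtopology ?Z ?W) ?X ?s"
    by (auto simp: continuous_map_in_subtopology subtopology_subtopology intro: continuous_on_ladder_from)
  moreover have "\<forall>w\<in>?W. ?f (?s w) = w"
    by (auto intro!: frame_endomorphism_ladder_from)
  ultimately show "\<exists>W s. openin ?Z W \<and> M \<in> W \<and> continuous_map (subtopology ?Z W) ?X s \<and> (\<forall>w\<in>W. ?f (s w) = w)"
    by blast
qed simp

lemma homeomorphic_map_pullback_topology:
  assumes "inj_on f A" "f ` A \<subseteq> topspace Z"
  shows "homeomorphic_map (pullback_topology A f Z) (subtopology Z (f ` A)) f"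
  unfolding homeomorphic_map_def quotient_map_def
proof (intro conjI allI impI)
  have top: "topspace (pullback_topology A f Z) = A"
    using assms(2) by (auto simp: topspace_pullback_topology)
  show "inj_on f (topspace (pullback_topology A f Z))" using assms(1) top by simp
  show "f ` topspace (pullback_topology A f Z) = topspace (subtopology Z (f ` A))"
    using assms(2) by (auto simp: top)
  fix U assume "U \<subseteq> topspace (subtopology Z (f ` A))"
  then have "{x \<in> A. f x \<in> U} = f -` T \<inter> A \<longleftrightarrow> U = T \<inter> f ` A" for T
    by auto
  then show "openin (pullback_topology A f Z) {x \<in> topspace (pullback_topology A f Z). f x \<in> U}
      = openin (subtopology Z (f ` A)) U"
    by (simp add: top openin_pullback_topology openin_subtopology)
qed

text \<open>Both the projection to jets of curves and \<open>F\<close> on frames are quotient maps with the same fibres, so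
  the quotients agree.\<close>

lemma homeomorphic_map_fundamental_endomorphism:
  fixes Y :: "('n::finite, 'k::{finite,linorder}) frame_jet set topology"
  assumes top: "topspace Y = fanning_curve_jets"
    and quot: "quotient_map (top_of_set fanning_frame_jets) Y curve_jet"
  shows "homeomorphic_map Y (top_of_set (frame_endomorphism ` fanning_frame_jets)) fundamental_endomorphism"
proof -
  let ?X = "top_of_set (fanning_frame_jets :: ('n, 'k) frame_jet set)"
  let ?Z = "top_of_set (frame_endomorphism ` (fanning_frame_jets :: ('n, 'k) frame_jet set))"
  have q: "quotient_map ?X ?Z (fundamental_endomorphism \<circ> curve_jet)"
    by (rule quotient_map_eq[OF quotient_map_frame_endomorphism])
       (simp add: fundamental_endomorphism_curve_jet)
  then have "continuous_map Y ?Z fundamental_endomorphism"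
    using continuous_compose_quotient_map[OF quot] quotient_imp_continuous_map by blast
  then have "quotient_map Y ?Z fundamental_endomorphism"
    using quotient_map_from_composition[OF quotient_imp_continuous_map[OF quot] _ q] by blast
  then show ?thesis
    by (simp add: homeomorphic_map_def top inj_on_fundamental_endomorphism)
qed

text \<open>The converse: any topology which \<open>F\<close> identifies with the orbit is the quotient topology.\<close>

lemma quotient_map_curve_jet:
  fixes Y :: "('n::finite, 'k::{finite,linorder}) frame_jet set topology"
  assumes top: "topspace Y = fanning_curve_jets"
    and homeo: "homeomorphic_map Y (top_of_set (frame_endomorphism ` fanning_frame_jets)) fundamental_endomorphism"
  shows "quotient_map (top_of_set fanning_frame_jets) Y curve_jet"
proof -
  let ?Z = "top_of_set (frame_endomorphism ` (fanning_frame_jets :: ('n, 'k) frame_jet set))"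
  obtain g where g: "homeomorphic_maps Y ?Z fundamental_endomorphism g"
    using homeo homeomorphic_map_maps by blast
  then have "quotient_map ?Z Y g"
    using homeomorphic_maps_map unfolding homeomorphic_map_def by blast
  then have "quotient_map (top_of_set fanning_frame_jets) Y (g \<circ> frame_endomorphism)"
    by (rule quotient_map_compose[OF quotient_map_frame_endomorphism])
  then show ?thesis
  proof (rule quotient_map_eq)
    fix a :: "('n, 'k) frame_jet" assume "a \<in> topspace (top_of_set fanning_frame_jets)"
    then have a: "a \<in> fanning_frame_jets" "curve_jet a \<in> topspace Y"
      by (auto simp: top fanning_curve_jets_eq)
    then have "g (fundamental_endomorphism (curve_jet a)) = curve_jet a"
      using g by (simp add: homeomorphic_maps_def)
    then show "(g \<circ> frame_endomorphism) a = curve_jet a"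
      by (simp add: fundamental_endomorphism_curve_jet a)
  qed
qed


section \<open>Charts and smooth maps\<close>

lemma Ck_on_differentiable: "(\<And>m. Ck_on m f S) \<Longrightarrow> x \<in> S \<Longrightarrow> f differentiable (at x)"
  using Ck_on.simps(2) by blast

lemma frechet_derivative_chain:
  assumes "open W" "x \<in> W" "g differentiable (at x)" "f differentiable (at (g x))"
    and "\<And>y. y \<in> W \<Longrightarrow> h y = f (g y)"
  shows "frechet_derivative h (at x) = frechet_derivative f (at (g x)) \<circ> frechet_derivative g (at x)"
proof -
  have "((f \<circ> g) has_derivative (frechet_derivative f (at (g x)) \<circ> frechet_derivative g (at x))) (at x)"
    using assms(3,4) by (intro diff_chain_at) (simp_all add: frechet_derivative_works)
  then have "(h has_derivative (frechet_derivative f (at (g x)) \<circ> frechet_derivative g (at x))) (at x)"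
    by (rule has_derivative_transform_within_open[OF _ assms(1,2)]) (simp add: assms(5))
  then show ?thesis by (rule frechet_derivative_at[symmetric])
qed

lemma frechet_derivative_local_inverse:
  assumes "open W" "x \<in> W" "g differentiable (at x)" "f differentiable (at (g x))"
    and "\<And>y. y \<in> W \<Longrightarrow> f (g y) = y"
  shows "frechet_derivative f (at (g x)) \<circ> frechet_derivative g (at x) = id"
  using frechet_derivative_chain[OF assms(1-4), of id] assms(5) by simp

lemma surj_comp_left: "surj (f \<circ> g) \<Longrightarrow> surj f"
  by (auto simp: surj_def)

lemma smooth_on_cong:
  assumes "open S" "smooth_on f S" "\<And>x. x \<in> S \<Longrightarrow> f x = g x"
  shows "smooth_on g S"
  using assms Ck_on_cong unfolding smooth_on_def by blast

lemma frechet_derivative_cong: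
  assumes "open S" "smooth_on f S" "x \<in> S" "\<And>x. x \<in> S \<Longrightarrow> f x = g x"
  shows "frechet_derivative f (at x) = frechet_derivative g (at x)"
proof (rule frechet_derivative_transform_within_open)
  show "f differentiable (at x)"
    by (rule Ck_on_differentiable) (use assms in \<open>auto simp: smooth_on_def\<close>)
qed (use assms in auto)

lemma smooth_manifold_chartD:
  assumes "smooth_manifold Y \<B>" "(U, \<phi>) \<in> \<B>"
  shows "openin Y U" and "U \<subseteq> topspace Y" and "open (\<phi> ` U)"
    and "homeomorphic_map (subtopology Y U) (top_of_set (\<phi> ` U)) \<phi>" and "inj_on \<phi> U"
proof -
  show 1: "openin Y U" "open (\<phi> ` U)" and
    2: "homeomorphic_map (subtopology Y U) (top_of_set (\<phi> ` U)) \<phi>"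
    using assms unfolding smooth_manifold_def by blast+
  show 3: "U \<subseteq> topspace Y" using 1(1) by (rule openin_subset)
  from 2 have "inj_on \<phi> (topspace (subtopology Y U))" by (simp add: homeomorphic_map_def)
  then show "inj_on \<phi> U" using 3 by (simp add: Int_absorb1)
qed

lemma ball_pairI: "(\<And>x y. (x, y) \<in> A \<Longrightarrow> P x y) \<Longrightarrow> \<forall>(x, y)\<in>A. P x y"
  by auto

lemma smooth_manifold_transition:
  assumes "smooth_manifold Y \<B>" "(U, \<phi>) \<in> \<B>" "(V, \<psi>) \<in> \<B>"
  shows "smooth_on (\<psi> \<circ> inv_into U \<phi>) (\<phi> ` (U \<inter> V))"
proof -
  have "\<forall>(U, \<phi>)\<in>\<B>. \<forall>(V, \<psi>)\<in>\<B>. smooth_on (\<psi> \<circ> inv_into U \<phi>) (\<phi> ` (U \<inter> V))"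
    using assms(1) unfolding smooth_manifold_def by (elim conjE)
  from bspec[OF this assms(2)] have "\<forall>(V, \<psi>)\<in>\<B>. smooth_on (\<psi> \<circ> inv_into U \<phi>) (\<phi> ` (U \<inter> V))"
    by simp
  from bspec[OF this assms(3)] show ?thesis by simp
qed

lemma smooth_map_chartD:
  assumes "smooth_map X \<A> Y \<B> f" "(U, \<phi>) \<in> \<A>" "(V, \<psi>) \<in> \<B>"
  shows "smooth_on (\<psi> \<circ> f \<circ> inv_into U \<phi>) (\<phi> ` {x \<in> U. f x \<in> V})"
proof -
  have "\<forall>(U, \<phi>)\<in>\<A>. \<forall>(V, \<psi>)\<in>\<B>. smooth_on (\<psi> \<circ> f \<circ> inv_into U \<phi>) (\<phi> ` {x \<in> U. f x \<in> V})"
    using assms(1) unfolding smooth_map_def by (elim conjE)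
  from bspec[OF this assms(2)] have "\<forall>(V, \<psi>)\<in>\<B>. smooth_on (\<psi> \<circ> f \<circ> inv_into U \<phi>) (\<phi> ` {x \<in> U. f x \<in> V})"
    by simp
  from bspec[OF this assms(3)] show ?thesis by simp
qed

lemma immersion_chartD:
  assumes "immersion X \<A> Y \<B> f" "(U, \<phi>) \<in> \<A>" "(V, \<psi>) \<in> \<B>" "x \<in> U" "f x \<in> V"
  shows "inj (frechet_derivative (\<psi> \<circ> f \<circ> inv_into U \<phi>) (at (\<phi> x)))"
proof -
  have "\<forall>(U, \<phi>)\<in>\<A>. \<forall>(V, \<psi>)\<in>\<B>. \<forall>x\<in>U. f x \<in> V \<longrightarrow> inj (frechet_derivative (\<psi> \<circ> f \<circ> inv_into U \<phi>) (at (\<phi> x)))"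
    using assms(1) unfolding immersion_def by (elim conjE)
  from bspec[OF this assms(2)] have "\<forall>(V, \<psi>)\<in>\<B>. \<forall>x\<in>U. f x \<in> V \<longrightarrow> inj (frechet_derivative (\<psi> \<circ> f \<circ> inv_into U \<phi>) (at (\<phi> x)))"
    by simp
  from bspec[OF this assms(3)] show ?thesis using assms(4,5) by simp
qed

lemma submersion_chartD:
  assumes "submersion X \<A> Y \<B> f" "(U, \<phi>) \<in> \<A>" "(V, \<psi>) \<in> \<B>" "x \<in> U" "f x \<in> V"
  shows "surj (frechet_derivative (\<psi> \<circ> f \<circ> inv_into U \<phi>) (at (\<phi> x)))"
proof -
  have "\<forall>(U, \<phi>)\<in>\<A>. \<forall>(V, \<psi>)\<in>\<B>. \<forall>x\<in>U. f x \<in> V \<longrightarrow> surj (frechet_derivative (\<psi> \<circ> f \<circ> inv_into U \<phi>) (at (\<phi> x)))"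
    using assms(1) unfolding submersion_def by (elim conjE)
  from bspec[OF this assms(2)] have "\<forall>(V, \<psi>)\<in>\<B>. \<forall>x\<in>U. f x \<in> V \<longrightarrow> surj (frechet_derivative (\<psi> \<circ> f \<circ> inv_into U \<phi>) (at (\<phi> x)))"
    by simp
  from bspec[OF this assms(3)] show ?thesis using assms(4,5) by simp
qed

lemma smooth_manifold_chart_image_open:
  assumes "smooth_manifold Y \<B>" "(U, \<phi>) \<in> \<B>" "openin Y A" "A \<subseteq> U"
  shows "open (\<phi> ` A)"
proof -
  note c = smooth_manifold_chartD[OF assms(1,2)]
  have "openin (subtopology Y U) A"
    using assms(3,4) by (metis inf.absorb_iff2 openin_subtopology_Int2)
  then have "openin (top_of_set (\<phi> ` U)) (\<phi> ` A)"
    using homeomorphic_imp_open_map[OF c(4)] unfolding open_map_def by blast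
  then show ?thesis using c(3) openin_open_trans by blast
qed

lemma smooth_manifold_chart_inverse_continuous:
  assumes "smooth_manifold Y \<B>" "(U, \<phi>) \<in> \<B>"
  shows "continuous_map (top_of_set (\<phi> ` U)) Y (inv_into U \<phi>)"
proof -
  note c = smooth_manifold_chartD[OF assms]
  obtain g where g: "homeomorphic_maps (subtopology Y U) (top_of_set (\<phi> ` U)) \<phi> g"
    using c(4) homeomorphic_map_maps by blast
  have "g y = inv_into U \<phi> y" if "y \<in> \<phi> ` U" for y
  proof -
    have "g (\<phi> x) = x" if "x \<in> U" for x
      using g c(2) that by (auto simp: homeomorphic_maps_def)
    then show ?thesis using that c(5) by auto
  qed
  moreover have "continuous_map (top_of_set (\<phi> ` U)) Y g"
    using g by (auto simp: homeomorphic_maps_def continuous_map_in_subtopology)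
  ultimately show ?thesis
    by (rule_tac continuous_map_eq[of _ _ g]) auto
qed

lemma smooth_manifold_open_set_atlas:
  "open S \<Longrightarrow> smooth_manifold (top_of_set S) (open_set_atlas S)"
proof -
  assume S: "open S"
  have "second_countable (euclidean :: 'a topology)"
  proof -
    obtain \<B> :: "'a set set" where "countable \<B>" "\<And>C. C \<in> \<B> \<Longrightarrow> open C"
      "\<And>S. open S \<Longrightarrow> \<exists>U. U \<subseteq> \<B> \<and> S = \<Union>U"
      using univ_second_countable by metis
    then have "\<forall>U x. openin euclidean U \<and> x \<in> U \<longrightarrow> (\<exists>V\<in>\<B>. x \<in> V \<and> V \<subseteq> U)"
      by (metis Union_iff Union_upper open_openin subset_iff)
    with \<open>countable \<B>\<close> \<open>\<And>C. C \<in> \<B> \<Longrightarrow> open C\<close> show ?thesis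
      unfolding second_countable_def by (intro exI[of _ \<B>]) auto
  qed
  then have "second_countable (top_of_set S)" by (rule second_countable_subtopology)
  moreover have "smooth_on (id \<circ> inv_into S id) S"
    by (rule smooth_on_cong[OF S, of "\<lambda>x. x"]) (simp_all add: smooth_on_def Ck_on_id f_inv_into_f[of _ id, simplified])
  ultimately show ?thesis
    using S by (simp add: smooth_manifold_def Hausdorff_space_subtopology subtopology_subtopology)
qed

text \<open>The image gets the charts of \<open>Y\<close> composed with the inverse of \<open>f\<close>. Their transition maps are those of \<open>Y\<close>,
  and in them the inclusion of the image is represented by the same map as \<open>f\<close> itself.\<close>

lemma smooth_embedding_image:
  fixes Y :: "'a topology" and \<B> :: "('a, 'e::euclidean_space) chart set"
    and Z :: "'b topology" and \<D> :: "('b, 'f::euclidean_space) chart set"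
  assumes Y: "smooth_manifold Y \<B>" and Z: "smooth_manifold Z \<D>" and f: "smooth_embedding Y \<B> Z \<D> f"
  shows "\<exists>\<C> :: ('b, 'e) chart set. embedded_submanifold (f ` topspace Y) \<C> Z \<D> \<and>
           diffeomorphism Y \<B> (subtopology Z (f ` topspace Y)) \<C> f"
proof -
  let ?Z = "subtopology Z (f ` topspace Y)"
  have homeo: "homeomorphic_map Y ?Z f" and imm: "immersion Y \<B> Z \<D> f"
    using f by (auto simp: smooth_embedding_def embedding_map_def)
  then have smo: "smooth_map Y \<B> Z \<D> f" unfolding immersion_def by (elim conjE)
  have contf: "continuous_map Y Z f"
    using homeomorphic_imp_continuous_map[OF homeo] by (simp add: continuous_map_in_subtopology)
  have sub: "f ` topspace Y \<subseteq> topspace Z"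
    using contf by (auto simp: continuous_map_def)
  obtain g where maps: "homeomorphic_maps Y ?Z f g"
    using homeo homeomorphic_map_maps by blast
  have gf: "g (f x) = x" if "x \<in> topspace Y" for x
    using maps that by (simp add: homeomorphic_maps_def)
  have inj: "inj_on f (topspace Y)" using gf by (metis inj_onI)
  note ch = smooth_manifold_chartD[OF Y]
  define \<C> where "\<C> = (\<lambda>(U, \<phi>). (f ` U, \<phi> \<circ> g)) ` \<B>"
  have C: "\<forall>(U, \<phi>)\<in>\<C>. P U \<phi>" if "\<And>U \<phi>. (U, \<phi>) \<in> \<B> \<Longrightarrow> P (f ` U) (\<phi> \<circ> g)" for P
    using that by (auto simp: \<C>_def)
  have img: "(\<phi> \<circ> g) ` (f ` A) = \<phi> ` A" if "A \<subseteq> topspace Y" for A and \<phi> :: "'a \<Rightarrow> 'e"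
    using gf that by (force simp: image_image intro: image_cong)
  have inv: "inv_into (f ` U) (\<phi> \<circ> g) y = f (inv_into U \<phi> y)" if "(U, \<phi>) \<in> \<B>" "y \<in> \<phi> ` U" for U \<phi> y
  proof -
    have gfU: "g (f x) = x" if "x \<in> U" for x
      using that ch(2)[OF \<open>(U, \<phi>) \<in> \<B>\<close>] by (intro gf) blast
    have "inj_on (\<phi> \<circ> g) (f ` U)"
    proof (rule inj_onI)
      fix y z assume "y \<in> f ` U" "z \<in> f ` U" and eq: "(\<phi> \<circ> g) y = (\<phi> \<circ> g) z"
      then obtain u v where uv: "u \<in> U" "v \<in> U" "y = f u" "z = f v" by blast
      with eq have "\<phi> u = \<phi> v" by (simp add: gfU)
      then show "y = z" using inj_onD[OF ch(5)[OF that(1)]] uv by blast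
    qed
    moreover have "inv_into U \<phi> y \<in> U" by (rule inv_into_into[OF that(2)])
    moreover have "(\<phi> \<circ> g) (f (inv_into U \<phi> y)) = y"
      unfolding comp_apply gfU[OF inv_into_into[OF that(2)]] by (rule f_inv_into_f[OF that(2)])
    ultimately show ?thesis
      by (intro inv_into_f_eq imageI)
  qed
  have trans: "smooth_on (\<psi> \<circ> inv_into U \<phi>) (\<phi> ` (U \<inter> V))" "open (\<phi> ` (U \<inter> V))"
    if "(U, \<phi>) \<in> \<B>" "(V, \<psi>) \<in> \<B>" for U \<phi> V \<psi>
  proof -
    show "smooth_on (\<psi> \<circ> inv_into U \<phi>) (\<phi> ` (U \<inter> V))"
      by (rule smooth_manifold_transition[OF Y that])
    show "open (\<phi> ` (U \<inter> V))"
      by (rule smooth_manifold_chart_image_open[OF Y that(1) openin_Int[OF ch(1)[OF that(1)] ch(1)[OF that(2)]] Int_lower1])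
  qed
  have man: "smooth_manifold ?Z \<C>"
  proof -
    have base: "Hausdorff_space ?Z" "second_countable ?Z"
      using Z by (auto simp: smooth_manifold_def Hausdorff_space_subtopology second_countable_subtopology)
    have chart: "openin ?Z (f ` U) \<and> open ((\<phi> \<circ> g) ` (f ` U)) \<and>
        homeomorphic_map (subtopology ?Z (f ` U)) (top_of_set ((\<phi> \<circ> g) ` (f ` U))) (\<phi> \<circ> g)"
      if U: "(U, \<phi>) \<in> \<B>" for U \<phi>
    proof (intro conjI)
      show "openin ?Z (f ` U)"
        using homeomorphic_imp_open_map[OF homeo] ch(1)[OF U] unfolding open_map_def by blast
      show "open ((\<phi> \<circ> g) ` (f ` U))"
        unfolding img[OF ch(2)[OF U]] by (rule ch(3)[OF U])
      have "homeomorphic_map ?Z Y g"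
        using maps homeomorphic_maps_map by blast
      then have "homeomorphic_map (subtopology ?Z (f ` U)) (subtopology Y U) g"
      proof (rule homeomorphic_map_subtopologies)
        have "topspace ?Z \<inter> f ` U = f ` U" using sub ch(2)[OF U] by auto
        moreover have "g ` f ` U = U"
          using img[OF ch(2)[OF U]] gf ch(2)[OF U] by (force simp: image_image)
        ultimately show "g ` (topspace ?Z \<inter> f ` U) = topspace Y \<inter> U"
          using ch(2)[OF U] by auto
      qed
      then show "homeomorphic_map (subtopology ?Z (f ` U)) (top_of_set ((\<phi> \<circ> g) ` (f ` U))) (\<phi> \<circ> g)"
        unfolding img[OF ch(2)[OF U]] by (rule homeomorphic_map_compose[OF _ ch(4)[OF U]])
    qed
    have cover: "(\<Union>(U, \<phi>)\<in>\<C>. U) = topspace ?Z"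
    proof -
      have "(\<Union>(U, \<phi>)\<in>\<B>. U) = topspace Y" using Y by (simp add: smooth_manifold_def)
      moreover have "(\<Union>(U, \<phi>)\<in>\<C>. U) = f ` (\<Union>(U, \<phi>)\<in>\<B>. U)"
        by (simp add: \<C>_def image_UN split_beta)
      moreover have "topspace ?Z = f ` topspace Y" using sub by auto
      ultimately show ?thesis by simp
    qed
    have tr: "smooth_on ((\<psi> \<circ> g) \<circ> inv_into (f ` U) (\<phi> \<circ> g)) ((\<phi> \<circ> g) ` (f ` U \<inter> f ` V))"
      if U: "(U, \<phi>) \<in> \<B>" and V: "(V, \<psi>) \<in> \<B>" for U \<phi> V \<psi>
    proof -
      have "f ` U \<inter> f ` V = f ` (U \<inter> V)"
        using inj_on_image_Int[OF inj ch(2)[OF U] ch(2)[OF V]] by simp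
      moreover have "U \<inter> V \<subseteq> topspace Y" using ch(2)[OF U] by auto
      ultimately have eq: "(\<phi> \<circ> g) ` (f ` U \<inter> f ` V) = \<phi> ` (U \<inter> V)"
        using img by simp
      show ?thesis
        unfolding eq
      proof (rule smooth_on_cong[OF trans(2)[OF U V] trans(1)[OF U V]])
        fix y assume "y \<in> \<phi> ` (U \<inter> V)"
        then have y: "y \<in> \<phi> ` U" by auto
        have "inv_into U \<phi> y \<in> topspace Y" by (rule subsetD[OF ch(2)[OF U] inv_into_into[OF y]])
        then show "(\<psi> \<circ> inv_into U \<phi>) y = ((\<psi> \<circ> g) \<circ> inv_into (f ` U) (\<phi> \<circ> g)) y"
          by (simp add: inv[OF U y] gf)
      qed
    qed
    show ?thesis
      unfolding smooth_manifold_def by (intro conjI base cover C chart tr)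
  qed
  have emb: "smooth_embedding ?Z \<C> Z \<D> id"
  proof -
    have loc: "smooth_on (\<psi> \<circ> f \<circ> inv_into U \<phi>) (\<phi> ` {x \<in> U. f x \<in> V})"
      "open (\<phi> ` {x \<in> U. f x \<in> V})"
      "(\<phi> \<circ> g) ` {x \<in> f ` U. id x \<in> V} = \<phi> ` {x \<in> U. f x \<in> V}"
      "\<And>y. y \<in> \<phi> ` {x \<in> U. f x \<in> V} \<Longrightarrow> (\<psi> \<circ> f \<circ> inv_into U \<phi>) y = (\<psi> \<circ> id \<circ> inv_into (f ` U) (\<phi> \<circ> g)) y"
      if U: "(U, \<phi>) \<in> \<B>" and V: "(V, \<psi>) \<in> \<D>" for U \<phi> V \<psi>
    proof -
      show "smooth_on (\<psi> \<circ> f \<circ> inv_into U \<phi>) (\<phi> ` {x \<in> U. f x \<in> V})"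
        by (rule smooth_map_chartD[OF smo U V])
      have "{x \<in> U. f x \<in> V} = U \<inter> {x \<in> topspace Y. f x \<in> V}"
        using ch(2)[OF U] by auto
      moreover have "openin Y {x \<in> topspace Y. f x \<in> V}"
        by (rule openin_continuous_map_preimage[OF contf smooth_manifold_chartD(1)[OF Z V]])
      ultimately show "open (\<phi> ` {x \<in> U. f x \<in> V})"
        using ch(1)[OF U] by (intro smooth_manifold_chart_image_open[OF Y U]) auto
      have "{x \<in> f ` U. id x \<in> V} = f ` {x \<in> U. f x \<in> V}" by auto
      moreover have "{x \<in> U. f x \<in> V} \<subseteq> topspace Y" using ch(2)[OF U] by auto
      ultimately show "(\<phi> \<circ> g) ` {x \<in> f ` U. id x \<in> V} = \<phi> ` {x \<in> U. f x \<in> V}"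
        using img by simp
      show "(\<psi> \<circ> f \<circ> inv_into U \<phi>) y = (\<psi> \<circ> id \<circ> inv_into (f ` U) (\<phi> \<circ> g)) y"
        if "y \<in> \<phi> ` {x \<in> U. f x \<in> V}" for y
        using that by (subst comp_apply, subst comp_apply, subst comp_apply, subst comp_apply, subst inv[OF U]) auto
    qed
    have "smooth_map ?Z \<C> Z \<D> id"
      unfolding smooth_map_def
    proof (intro conjI)
      show "continuous_map ?Z Z id" by (simp add: continuous_map_from_subtopology)
      have "smooth_on (\<psi> \<circ> id \<circ> inv_into (f ` U) (\<phi> \<circ> g)) ((\<phi> \<circ> g) ` {x \<in> f ` U. id x \<in> V})"
        if U: "(U, \<phi>) \<in> \<B>" and V: "(V, \<psi>) \<in> \<D>" for U \<phi> V \<psi>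
        unfolding loc(3)[OF U V] by (rule smooth_on_cong[OF loc(2)[OF U V] loc(1)[OF U V] loc(4)[OF U V]])
      then show "\<forall>(U, \<phi>)\<in>\<C>. \<forall>(V, \<psi>)\<in>\<D>. smooth_on (\<psi> \<circ> id \<circ> inv_into U \<phi>) (\<phi> ` {x \<in> U. id x \<in> V})"
        by (intro C ball_pairI)
    qed
    moreover have "inj (frechet_derivative (\<psi> \<circ> id \<circ> inv_into (f ` U) (\<phi> \<circ> g)) (at ((\<phi> \<circ> g) (f x))))"
      if U: "(U, \<phi>) \<in> \<B>" and V: "(V, \<psi>) \<in> \<D>" and x: "x \<in> U" "f x \<in> V" for U \<phi> V \<psi> x
    proof -
      have "inj (frechet_derivative (\<psi> \<circ> f \<circ> inv_into U \<phi>) (at (\<phi> x)))"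
        by (rule immersion_chartD[OF imm U V x])
      moreover have "frechet_derivative (\<psi> \<circ> f \<circ> inv_into U \<phi>) (at (\<phi> x))
          = frechet_derivative (\<psi> \<circ> id \<circ> inv_into (f ` U) (\<phi> \<circ> g)) (at (\<phi> x))"
        by (rule frechet_derivative_cong[OF loc(2)[OF U V] loc(1)[OF U V] _ loc(4)[OF U V]]) (use x in auto)
      moreover have "(\<phi> \<circ> g) (f x) = \<phi> x" using gf ch(2)[OF U] x by auto
      ultimately show ?thesis by simp
    qed
    ultimately have "immersion ?Z \<C> Z \<D> id"
      unfolding immersion_def by (intro conjI C ball_pairI) auto
    moreover have "embedding_map ?Z Z id"
      unfolding embedding_map_def homeomorphic_map_id
      using sub by (simp add: Int_absorb1)
    ultimately show ?thesis by (simp add: smooth_embedding_def)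
  qed
  have "smooth_map Y \<B> ?Z \<C> f"
    unfolding smooth_map_def
  proof (intro conjI homeomorphic_imp_continuous_map[OF homeo])
    have "smooth_on ((\<psi> \<circ> g) \<circ> f \<circ> inv_into U \<phi>) (\<phi> ` {x \<in> U. f x \<in> f ` V})"
      if U: "(U, \<phi>) \<in> \<B>" and V: "(V, \<psi>) \<in> \<B>" for U \<phi> V \<psi>
    proof -
      have eq: "{x \<in> U. f x \<in> f ` V} = U \<inter> V"
        using inj ch(2)[OF U] ch(2)[OF V] by (auto simp: inj_on_def subset_iff)
      show ?thesis
        unfolding eq
      proof (rule smooth_on_cong[OF trans(2)[OF U V] trans(1)[OF U V]])
        fix y assume "y \<in> \<phi> ` (U \<inter> V)"
        then have y: "y \<in> \<phi> ` U" by auto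
        have "inv_into U \<phi> y \<in> topspace Y" by (rule subsetD[OF ch(2)[OF U] inv_into_into[OF y]])
        then show "(\<psi> \<circ> inv_into U \<phi>) y = ((\<psi> \<circ> g) \<circ> f \<circ> inv_into U \<phi>) y"
          by (simp add: gf)
      qed
    qed
    then show "\<forall>(U, \<phi>)\<in>\<B>. \<forall>(V, \<psi>)\<in>\<C>. smooth_on (\<psi> \<circ> f \<circ> inv_into U \<phi>) (\<phi> ` {x \<in> U. f x \<in> V})"
      by (intro C ball_pairI)
  qed
  moreover have "smooth_map ?Z \<C> Y \<B> g"
    unfolding smooth_map_def
  proof (intro conjI)
    show "continuous_map ?Z Y g" using maps by (simp add: homeomorphic_maps_def)
    have "smooth_on (\<psi> \<circ> g \<circ> inv_into (f ` U) (\<phi> \<circ> g)) ((\<phi> \<circ> g) ` {x \<in> f ` U. g x \<in> V})"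
      if U: "(U, \<phi>) \<in> \<B>" and V: "(V, \<psi>) \<in> \<B>" for U \<phi> V \<psi>
    proof -
      have "{x \<in> f ` U. g x \<in> V} = f ` (U \<inter> V)"
        using gf ch(2)[OF U] by (auto simp: subset_iff)
      moreover have "U \<inter> V \<subseteq> topspace Y" using ch(2)[OF U] by auto
      ultimately have eq: "(\<phi> \<circ> g) ` {x \<in> f ` U. g x \<in> V} = \<phi> ` (U \<inter> V)"
        using img by simp
      show ?thesis
        unfolding eq
      proof (rule smooth_on_cong[OF trans(2)[OF U V] trans(1)[OF U V]])
        fix y assume "y \<in> \<phi> ` (U \<inter> V)"
        then have y: "y \<in> \<phi> ` U" by auto
        have "inv_into U \<phi> y \<in> topspace Y" by (rule subsetD[OF ch(2)[OF U] inv_into_into[OF y]])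
        then show "(\<psi> \<circ> inv_into U \<phi>) y = (\<psi> \<circ> g \<circ> inv_into (f ` U) (\<phi> \<circ> g)) y"
          by (simp add: inv[OF U y] gf)
      qed
    qed
    then show "\<forall>(U, \<phi>)\<in>\<C>. \<forall>(V, \<psi>)\<in>\<B>. smooth_on (\<psi> \<circ> g \<circ> inv_into U \<phi>) (\<phi> ` {x \<in> U. g x \<in> V})"
      by (intro C ball_pairI)
  qed
  ultimately have "diffeomorphism Y \<B> ?Z \<C> f"
    unfolding diffeomorphism_def using maps by blast
  then show ?thesis
    using man emb sub unfolding embedded_submanifold_def by blast
qed


section \<open>Coordinates on the space of jets of fanning curves\<close>

definition only_last :: "real^'n^('k \<times> 'n) \<Rightarrow> ('n::finite, 'k::{finite,linorder}) frame_jet" where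
  "only_last B = (\<chi> j. if pos j = CARD('k) - 1 then B else 0)"

lemma last_entry_only_last: "last_entry (only_last B) = B"
  unfolding last_entry_def only_last_def
  by (subst jet_entry_vec_lambda[OF last_index, where f="\<lambda>m. if m = _ then B else 0"]) simp

lemma linear_last_entry: "linear last_entry"
  unfolding last_entry_def jet_entry_def by (rule linearI) simp_all

lemma last_entry_add:
  "last_entry (a + b :: ('a::real_vector, 'k::{finite,linorder}) vec) = last_entry a + last_entry b"
  by (rule linear_add[OF linear_last_entry])

lemma linear_jet_mult: "linear (\<lambda>a. jet_mult a x)"
  by (rule linearI)
     (simp_all add: jet_mult_def jet_entry_def vec_lambda_inject fun_eq_iff vec_eq_iff matrix_mult.add_left
       matrix_mult.scaleR_left scaleR_add_right sum.distrib scaleR_sum_right sum_distrib_left algebra_simps)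

text \<open>A linear isomorphism \<open>inc\<close> from the model space onto the frame jets with last entry \<open>0\<close>, with inverse
  extended by forgetting the last entry. It moves charts into the prescribed model space.\<close>

locale frame_coordinates =
  fixes inc :: "'e::euclidean_space \<Rightarrow> ('n::finite, 'k::{finite,linorder}) frame_jet"
    and coord :: "('n, 'k) frame_jet \<Rightarrow> 'e"
  assumes linear_inc: "linear inc" and linear_coord: "linear coord"
    and coord_inc: "coord (inc e) = e"
    and last_inc: "last_entry (inc e) = 0"
    and inc_coord: "inc (coord a) = a - only_last (last_entry a)"
begin

definition slice :: "real^'n^('k \<times> 'n) \<Rightarrow> 'e \<Rightarrow> ('n, 'k) frame_jet" where
  "slice B e = inc e + only_last B"

lemma last_slice: "last_entry (slice B e) = B"
  by (simp add: slice_def last_entry_add last_inc last_entry_only_last)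

lemma slice_coord: "slice (last_entry a) (coord a) = a"
  by (simp add: slice_def inc_coord)

lemma coord_slice: "coord (slice B e) = e"
proof -
  have "inc (coord (only_last B)) = 0"
    by (simp add: inc_coord last_entry_only_last)
  then have "coord (only_last B) = 0"
    using coord_inc[of "coord (only_last B)"] linear_0[OF linear_coord] by simp
  then show ?thesis by (simp add: slice_def linear_add[OF linear_coord] coord_inc)
qed

lemma Ck_on_slice: "Ck_on m (slice B) UNIV"
  unfolding slice_def[abs_def] by (intro Ck_on_add Ck_on_linear linear_inc Ck_on_const open_UNIV)

lemma continuous_on_slice: "continuous_on S (slice B)"
  using Ck_on_subset[OF Ck_on_slice[of 0], of S B] by simp

lemma slice_coord_ladder_from: "slice B (coord (ladder_from M B)) = ladder_from M B"
  using slice_coord[of "ladder_from M B"] by (simp add: last_entry_ladder_from)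

lemma ladder_from_slice:
  "slice B e \<in> fanning_frame_jets \<Longrightarrow> ladder_from (frame_endomorphism (slice B e)) B = slice B e"
  using ladder_from_frame_endomorphism[of "slice B e"] by (simp add: last_slice)

text \<open>The frame jets over the domain of the chart given by \<open>B\<close>: those equivalent to a fanning frame jet with
  last entry \<open>B\<close>.\<close>

definition chart_frames :: "real^'n^('k \<times> 'n) \<Rightarrow> ('n, 'k) frame_jet set" where
  "chart_frames B = {a \<in> fanning_frame_jets. ladder_from (frame_endomorphism a) B \<in> fanning_frame_jets}"

text \<open>The coordinates of the unique frame with last entry \<open>B\<close> equivalent to \<open>a\<close>; this is the local
  representative of the projection to jets of curves.\<close>

definition retract :: "real^'n^('k \<times> 'n) \<Rightarrow> ('n, 'k) frame_jet \<Rightarrow> 'e" where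
  "retract B a = coord (ladder_from (frame_endomorphism a) B)"

definition chart_dom :: "real^'n^('k \<times> 'n) \<Rightarrow> ('n, 'k) frame_jet set set" where
  "chart_dom B = {c \<in> fanning_curve_jets. ladder_from (fundamental_endomorphism c) B \<in> fanning_frame_jets}"

definition chart_coord :: "real^'n^('k \<times> 'n) \<Rightarrow> ('n, 'k) frame_jet set \<Rightarrow> 'e" where
  "chart_coord B c = coord (ladder_from (fundamental_endomorphism c) B)"

definition curve_jet_atlas :: "(('n, 'k) frame_jet set, 'e) chart set" where
  "curve_jet_atlas = range (\<lambda>B. (chart_dom B, chart_coord B))"

lemma open_chart_frames: "open (chart_frames B)"
proof -
  have "continuous_on fanning_frame_jets (\<lambda>a. ladder_from (frame_endomorphism a) B)"
    by (rule continuous_on_compose2[OF continuous_on_ladder_from[of UNIV] continuous_on_frame_endomorphism]) simp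
  from continuous_open_preimage[OF this open_fanning_frame_jets open_fanning_frame_jets]
  show ?thesis by (simp add: chart_frames_def vimage_def Int_def)
qed

lemma Ck_on_retract: "Ck_on m (retract B) (chart_frames B)"
proof -
  have "Ck_on m frame_endomorphism (chart_frames B)"
    by (rule Ck_on_subset[OF Ck_on_frame_endomorphism]) (auto simp: chart_frames_def)
  then have "Ck_on m (\<lambda>a. ladder_from (frame_endomorphism a) B) (chart_frames B)"
    by (rule Ck_on_compose[OF open_chart_frames _ Ck_on_ladder_from]) simp
  then show ?thesis
    unfolding retract_def[abs_def] by (rule Ck_on_linear_comp[OF linear_coord open_chart_frames])
qed

lemma slice_retract:
  assumes "a \<in> chart_frames B"
  shows "slice B (retract B a) \<in> fanning_frame_jets"
    and "frame_endomorphism (slice B (retract B a)) = frame_endomorphism a"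
    and "curve_jet (slice B (retract B a)) = curve_jet a"
proof -
  have a: "a \<in> fanning_frame_jets" and l: "ladder_from (frame_endomorphism a) B \<in> fanning_frame_jets"
    using assms by (auto simp: chart_frames_def)
  have s: "slice B (retract B a) = ladder_from (frame_endomorphism a) B"
    by (simp add: retract_def slice_coord_ladder_from)
  show 1: "slice B (retract B a) \<in> fanning_frame_jets" using l s by simp
  show 2: "frame_endomorphism (slice B (retract B a)) = frame_endomorphism a"
    unfolding s by (rule frame_endomorphism_ladder_from[OF l]) (use a in auto)
  show "curve_jet (slice B (retract B a)) = curve_jet a"
    using 1 2 a by (simp add: curve_jet_eq)
qed

lemma slice_in_chart_frames: "slice B e \<in> chart_frames B \<longleftrightarrow> slice B e \<in> fanning_frame_jets"
  by (auto simp: chart_frames_def ladder_from_slice)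

lemma retract_slice: "slice B e \<in> fanning_frame_jets \<Longrightarrow> retract B (slice B e) = e"
  by (simp add: retract_def ladder_from_slice coord_slice)

lemma curve_jet_in_chart_dom:
  "a \<in> fanning_frame_jets \<Longrightarrow> curve_jet a \<in> chart_dom B \<longleftrightarrow> a \<in> chart_frames B"
  by (auto simp: chart_dom_def chart_frames_def fundamental_endomorphism_curve_jet fanning_curve_jets_eq)

lemma chart_dom_eq: "chart_dom B = curve_jet ` chart_frames B"
  by (auto simp: chart_dom_def chart_frames_def fundamental_endomorphism_curve_jet fanning_curve_jets_eq)

lemma chart_coord_curve_jet:
  "a \<in> fanning_frame_jets \<Longrightarrow> chart_coord B (curve_jet a) = retract B a"
  by (simp add: chart_coord_def retract_def fundamental_endomorphism_curve_jet)

lemma chart_coord_inverse: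
  assumes "c \<in> chart_dom B"
  shows "slice B (chart_coord B c) \<in> fanning_frame_jets" and "curve_jet (slice B (chart_coord B c)) = c"
proof -
  obtain a where a: "a \<in> chart_frames B" "c = curve_jet a" using assms chart_dom_eq by blast
  then have "chart_coord B c = retract B a"
    by (simp add: chart_coord_curve_jet chart_frames_def)
  then show "slice B (chart_coord B c) \<in> fanning_frame_jets" "curve_jet (slice B (chart_coord B c)) = c"
    using slice_retract[OF a(1)] a(2) by simp_all
qed

lemma chart_coord_curve_jet_slice:
  assumes "slice B e \<in> fanning_frame_jets"
  shows "curve_jet (slice B e) \<in> chart_dom B" and "chart_coord B (curve_jet (slice B e)) = e"
  using assms
  by (simp_all add: curve_jet_in_chart_dom slice_in_chart_frames chart_coord_curve_jet retract_slice)

lemma inj_on_chart_coord: "inj_on (chart_coord B) (chart_dom B)"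
  using chart_coord_inverse(2) by (metis inj_onI)

lemma chart_coord_image:
  "chart_coord B ` (chart_dom B \<inter> chart_dom B') = {e. slice B e \<in> chart_frames B'} \<inter> {e. slice B e \<in> chart_frames B}"
proof (intro set_eqI iffI)
  fix e assume "e \<in> chart_coord B ` (chart_dom B \<inter> chart_dom B')"
  then obtain c where c: "c \<in> chart_dom B" "c \<in> chart_dom B'" "e = chart_coord B c" by blast
  note i = chart_coord_inverse[OF c(1)]
  show "e \<in> {e. slice B e \<in> chart_frames B'} \<inter> {e. slice B e \<in> chart_frames B}"
    using i c(2) curve_jet_in_chart_dom[OF i(1), of B'] by (simp add: c(3) slice_in_chart_frames)
next
  fix e assume "e \<in> {e. slice B e \<in> chart_frames B'} \<inter> {e. slice B e \<in> chart_frames B}"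
  then have "slice B e \<in> fanning_frame_jets" "slice B e \<in> chart_frames B'"
    by (auto simp: slice_in_chart_frames)
  then have "curve_jet (slice B e) \<in> chart_dom B \<inter> chart_dom B'" "chart_coord B (curve_jet (slice B e)) = e"
    using chart_coord_curve_jet_slice curve_jet_in_chart_dom by auto
  then show "e \<in> chart_coord B ` (chart_dom B \<inter> chart_dom B')" by (metis image_eqI)
qed

lemma chart_coord_dom_image: "chart_coord B ` chart_dom B = {e. slice B e \<in> fanning_frame_jets}"
  using chart_coord_image[of B B] by (simp add: slice_in_chart_frames)

lemma inv_chart_coord:
  "slice B e \<in> fanning_frame_jets \<Longrightarrow> inv_into (chart_dom B) (chart_coord B) e = curve_jet (slice B e)"
  by (rule inv_into_f_eq[OF inj_on_chart_coord]) (simp_all add: chart_coord_curve_jet_slice)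

lemma open_slice_preimage: "open W \<Longrightarrow> open {e. slice B e \<in> W}"
  using open_vimage[OF _ continuous_on_slice[of UNIV B]] by (simp add: vimage_def)

lemma Ck_on_slice_compose:
  assumes "open W" "Ck_on m f W"
  shows "Ck_on m (\<lambda>e. f (slice B e)) {e. slice B e \<in> W}"
  by (rule Ck_on_compose[OF open_slice_preimage[OF assms(1)] Ck_on_subset[OF Ck_on_slice] assms(2)]) auto

text \<open>Through \<open>a = jet_mult s x\<close>, with \<open>s\<close> on the slice, passes the translated slice \<open>e \<mapsto> jet_mult (slice B e) x\<close>,
  which is affine in \<open>e\<close> and a right inverse of \<open>retract B\<close>.\<close>

lemma retract_surj_derivative:
  assumes a: "a \<in> chart_frames B"
  shows "surj (frechet_derivative (retract B) (at a))"
proof -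
  let ?e = "retract B a"
  note s = slice_retract[OF a]
  have fan: "a \<in> fanning_frame_jets" using a by (simp add: chart_frames_def)
  have "(slice B ?e, a) \<in> same_curve_jet"
    using s fan by (simp add: same_curve_jet_iff)
  then obtain x where x: "x \<in> GL_jets" "a = jet_mult (slice B ?e) x"
    by (auto simp: same_curve_jet_def)
  let ?R = "\<lambda>e. jet_mult (slice B e) x"
  let ?W = "{e. slice B e \<in> fanning_frame_jets}"
  have Ra: "?R ?e = a" by (rule x(2)[symmetric])
  have "retract B (?R e) = e" if "e \<in> ?W" for e
  proof -
    have "(slice B e, ?R e) \<in> same_curve_jet"
      using that x(1) by (auto simp: same_curve_jet_def)
    then have "frame_endomorphism (?R e) = frame_endomorphism (slice B e)"
      by (simp add: same_curve_jet_iff)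
    then show ?thesis
      using retract_slice[of B e] that by (simp add: retract_def)
  qed
  moreover have "?R differentiable (at ?e)"
    by (rule Ck_on_differentiable[OF Ck_on_linear_comp[OF linear_jet_mult open_UNIV Ck_on_slice]]) simp
  moreover have "retract B differentiable (at (?R ?e))"
    unfolding Ra by (rule Ck_on_differentiable[OF Ck_on_retract a])
  moreover have "?e \<in> ?W" using s(1) by simp
  ultimately have "frechet_derivative (retract B) (at (?R ?e)) \<circ> frechet_derivative ?R (at ?e) = id"
    using open_slice_preimage[OF open_fanning_frame_jets] by (intro frechet_derivative_local_inverse)
  then have "frechet_derivative (retract B) (at a) (frechet_derivative ?R (at ?e) v) = v" for v
    unfolding Ra by (metis comp_apply id_apply)
  then show ?thesis by (rule surjI)
qed

text \<open>Pulling back along the injective map \<open>F\<close> gives Hausdorffness and second countability for free; that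
  this is the quotient topology is \<open>quotient_map_curve_jet_topology\<close>.\<close>

definition curve_jet_topology :: "('n, 'k) frame_jet set topology" where
  "curve_jet_topology = pullback_topology fanning_curve_jets fundamental_endomorphism euclidean"

lemma topspace_curve_jet_topology: "topspace curve_jet_topology = fanning_curve_jets"
  by (simp add: curve_jet_topology_def topspace_pullback_topology)

lemma homeomorphic_map_curve_jet_topology:
  "homeomorphic_map curve_jet_topology (top_of_set (frame_endomorphism ` fanning_frame_jets)) fundamental_endomorphism"
  unfolding curve_jet_topology_def fundamental_endomorphism_image[symmetric]
  by (rule homeomorphic_map_pullback_topology[OF inj_on_fundamental_endomorphism]) simp

lemma quotient_map_curve_jet_topology:
  "quotient_map (top_of_set fanning_frame_jets) curve_jet_topology curve_jet"
  by (rule quotient_map_curve_jet[OF topspace_curve_jet_topology homeomorphic_map_curve_jet_topology])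

lemma continuous_map_fundamental_endomorphism:
  "continuous_map curve_jet_topology euclidean fundamental_endomorphism"
  using homeomorphic_imp_continuous_map[OF homeomorphic_map_curve_jet_topology]
  by (simp add: continuous_map_in_subtopology)

lemma openin_chart_dom: "openin curve_jet_topology (chart_dom B)"
proof -
  have "open ((\<lambda>M. ladder_from M B) -` fanning_frame_jets)"
    by (rule open_vimage[OF open_fanning_frame_jets continuous_on_ladder_from])
  then show ?thesis
    unfolding curve_jet_topology_def openin_pullback_topology
    by (intro exI[of _ "(\<lambda>M. ladder_from M B) -` fanning_frame_jets"]) (auto simp: chart_dom_def)
qed

lemma homeomorphic_map_chart_coord:
  "homeomorphic_map (subtopology curve_jet_topology (chart_dom B))
     (top_of_set (chart_coord B ` chart_dom B)) (chart_coord B)"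
proof (rule homeomorphic_maps_imp_map)
  have "continuous_map curve_jet_topology euclidean
      ((coord \<circ> (\<lambda>M. ladder_from M B)) \<circ> fundamental_endomorphism)"
  proof (rule continuous_map_compose[OF continuous_map_fundamental_endomorphism])
    have "continuous_on UNIV (coord \<circ> (\<lambda>M. ladder_from M B))"
      using Ck_on_linear_comp[OF linear_coord open_UNIV Ck_on_ladder_from[of 0]] by (simp add: comp_def)
    then show "continuous_map euclidean euclidean (coord \<circ> (\<lambda>M. ladder_from M B))" by simp
  qed
  then have "continuous_map curve_jet_topology euclidean (chart_coord B)"
    by (simp add: chart_coord_def[abs_def] comp_def)
  moreover have "continuous_map (top_of_set {e. slice B e \<in> fanning_frame_jets}) curve_jet_topology (curve_jet \<circ> slice B)"
    by (rule continuous_map_compose[OF _ quotient_imp_continuous_map[OF quotient_map_curve_jet_topology]])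
       (auto simp: continuous_map_in_subtopology intro: continuous_on_slice)
  ultimately show "homeomorphic_maps (subtopology curve_jet_topology (chart_dom B))
     (top_of_set (chart_coord B ` chart_dom B)) (chart_coord B) (curve_jet \<circ> slice B)"
    unfolding homeomorphic_maps_def chart_coord_dom_image
    using chart_coord_dom_image[of B]
    by (auto simp: continuous_map_in_subtopology continuous_map_from_subtopology chart_coord_inverse chart_coord_curve_jet_slice)
qed

lemma smooth_manifold_curve_jets: "smooth_manifold curve_jet_topology curve_jet_atlas"
proof -
  let ?Z = "top_of_set (frame_endomorphism ` (fanning_frame_jets :: ('n, 'k) frame_jet set))"
  have Z: "Hausdorff_space ?Z" "second_countable ?Z"
    using smooth_manifold_open_set_atlas[OF open_UNIV, where 'a="('n, 'k) big_matrix"]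
    by (auto simp: smooth_manifold_def Hausdorff_space_subtopology intro: second_countable_subtopology)
  have hom: "curve_jet_topology homeomorphic_space ?Z"
    using homeomorphic_map_curve_jet_topology homeomorphic_space by blast
  have base: "Hausdorff_space curve_jet_topology" "second_countable curve_jet_topology"
    using Z homeomorphic_Hausdorff_space[OF hom] homeomorphic_space_second_countability[OF hom] by auto
  have cover: "(\<Union>(U, \<phi>)\<in>curve_jet_atlas. U) = topspace curve_jet_topology"
  proof -
    have "c \<in> chart_dom (last_entry a)" if "a \<in> fanning_frame_jets" "c = curve_jet a" for a c
      using that curve_jet_in_chart_dom[of a "last_entry a"]
      by (simp add: chart_frames_def ladder_from_frame_endomorphism)
    then have "fanning_curve_jets = (\<Union>B. chart_dom B)"
      unfolding fanning_curve_jets_eq by (auto simp: chart_dom_def fanning_curve_jets_eq)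
    then show ?thesis by (simp add: curve_jet_atlas_def topspace_curve_jet_topology)
  qed
  have chart: "openin curve_jet_topology (chart_dom B) \<and> open (chart_coord B ` chart_dom B) \<and>
      homeomorphic_map (subtopology curve_jet_topology (chart_dom B))
        (top_of_set (chart_coord B ` chart_dom B)) (chart_coord B)" for B
    by (simp add: openin_chart_dom homeomorphic_map_chart_coord)
       (simp add: chart_coord_dom_image open_slice_preimage open_fanning_frame_jets)
  have trans: "smooth_on (chart_coord B' \<circ> inv_into (chart_dom B) (chart_coord B))
      (chart_coord B ` (chart_dom B \<inter> chart_dom B'))" for B B'
    unfolding chart_coord_image
  proof (rule smooth_on_cong)
    show op: "open ({e. slice B e \<in> chart_frames B'} \<inter> {e. slice B e \<in> chart_frames B})"
      by (intro open_Int open_slice_preimage open_chart_frames)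
    show "smooth_on (\<lambda>e. retract B' (slice B e)) ({e. slice B e \<in> chart_frames B'} \<inter> {e. slice B e \<in> chart_frames B})"
      unfolding smooth_on_def
      by (intro allI Ck_on_subset[OF Ck_on_slice_compose[OF open_chart_frames Ck_on_retract]]) auto
    show "retract B' (slice B e) = (chart_coord B' \<circ> inv_into (chart_dom B) (chart_coord B)) e"
      if "e \<in> {e. slice B e \<in> chart_frames B'} \<inter> {e. slice B e \<in> chart_frames B}" for e
      using that by (simp add: slice_in_chart_frames inv_chart_coord chart_coord_curve_jet)
  qed
  show ?thesis
    unfolding smooth_manifold_def
    by (intro conjI base cover) (auto simp: curve_jet_atlas_def chart trans)
qed

lemma curve_jet_chart_representation:
  assumes "a \<in> chart_frames B"
  shows "(chart_coord B \<circ> curve_jet \<circ> inv_into fanning_frame_jets id) a = retract B a"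
proof -
  have a: "a \<in> fanning_frame_jets" using assms by (simp add: chart_frames_def)
  then have "inv_into fanning_frame_jets id a = a"
    using f_inv_into_f[of a id fanning_frame_jets] by simp
  with a show ?thesis by (simp add: chart_coord_curve_jet)
qed

lemma submersion_curve_jet:
  "submersion (top_of_set fanning_frame_jets) (open_set_atlas fanning_frame_jets)
     curve_jet_topology curve_jet_atlas curve_jet"
proof -
  have dom: "id ` {a \<in> fanning_frame_jets. curve_jet a \<in> chart_dom B} = chart_frames B" for B
    using curve_jet_in_chart_dom[of _ B] by (auto simp: chart_frames_def)
  have sm: "smooth_on (retract B) (chart_frames B)" for B
    by (simp add: smooth_on_def Ck_on_retract)
  have "smooth_map (top_of_set fanning_frame_jets) (open_set_atlas fanning_frame_jets)
     curve_jet_topology curve_jet_atlas curve_jet"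
    unfolding smooth_map_def
  proof (intro conjI quotient_imp_continuous_map[OF quotient_map_curve_jet_topology] ball_pairI)
    fix U \<phi> V \<psi>
    assume "(U, \<phi>) \<in> open_set_atlas (fanning_frame_jets :: ('n, 'k) frame_jet set)" "(V, \<psi>) \<in> curve_jet_atlas"
    then obtain B where B: "U = fanning_frame_jets" "\<phi> = id" "V = chart_dom B" "\<psi> = chart_coord B"
      by (auto simp: curve_jet_atlas_def)
    show "smooth_on (\<psi> \<circ> curve_jet \<circ> inv_into U \<phi>) (\<phi> ` {x \<in> U. curve_jet x \<in> V})"
      unfolding B dom
      by (rule smooth_on_cong[OF open_chart_frames sm curve_jet_chart_representation[symmetric]])
  qed
  then show ?thesis
    unfolding submersion_def
  proof (intro conjI ball_pairI ballI impI)
    fix U \<phi> V \<psi> a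
    assume "(U, \<phi>) \<in> open_set_atlas (fanning_frame_jets :: ('n, 'k) frame_jet set)" "(V, \<psi>) \<in> curve_jet_atlas"
      and a: "a \<in> U" "curve_jet a \<in> V"
    then obtain B where B: "U = fanning_frame_jets" "\<phi> = id" "V = chart_dom B" "\<psi> = chart_coord B"
      by (auto simp: curve_jet_atlas_def)
    have a': "a \<in> chart_frames B" using a B curve_jet_in_chart_dom by blast
    have "frechet_derivative (retract B) (at a)
        = frechet_derivative (chart_coord B \<circ> curve_jet \<circ> inv_into fanning_frame_jets id) (at a)"
      by (rule frechet_derivative_cong[OF open_chart_frames sm a' curve_jet_chart_representation[symmetric]])
    then show "surj (frechet_derivative (\<psi> \<circ> curve_jet \<circ> inv_into U \<phi>) (at (\<phi> a)))"
      unfolding B id_apply using retract_surj_derivative[OF a'] by simp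
  qed
qed

lemma fanning_curve_jet_manifold_exists:
  "fanning_curve_jet_manifold curve_jet_topology curve_jet_atlas"
  using topspace_curve_jet_topology quotient_map_curve_jet_topology smooth_manifold_curve_jets submersion_curve_jet
  unfolding fanning_curve_jet_manifold_def quotient_manifold_def fanning_curve_jets_def curve_jet_def[abs_def]
  by simp

end


lemma dim_zero_component:
  "dim {a :: 'b::euclidean_space^'k::finite. a $ l = 0} = (CARD('k) - 1) * DIM('b)"
proof -
  let ?d = "(\<lambda>(i, b). axis i b) ` ((UNIV - {l}) \<times> Basis) :: ('b^'k) set"
  have "axis i u \<notin> ?d \<longleftrightarrow> i = l" if "u \<in> Basis" for i u
    using that nonzero_Basis by (auto simp: axis_eq_axis image_iff)
  then have "(\<forall>b\<in>Basis. b \<notin> ?d \<longrightarrow> a \<bullet> b = 0) \<longleftrightarrow> (\<forall>u\<in>Basis. a $ l \<bullet> u = 0)" for a :: "'b^'k"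
    by (auto simp: Basis_vec_def inner_axis)
  then have "{a :: 'b^'k. a $ l = 0} = {a. \<forall>b\<in>Basis. b \<notin> ?d \<longrightarrow> a \<bullet> b = 0}"
    by (auto simp: euclidean_all_zero_iff)
  also have "dim \<dots> = card ?d"
    by (rule dim_substandard) (auto simp: Basis_vec_def)
  also have "\<dots> = (CARD('k) - 1) * DIM('b)"
  proof -
    have "inj_on (\<lambda>(i, b). axis i b :: 'b^'k) ((UNIV - {l}) \<times> Basis)"
      using nonzero_Basis by (auto simp: inj_on_def axis_eq_axis)
    then show ?thesis
      by (simp add: card_image card_cartesian_product)
  qed
  finally show ?thesis .
qed

text \<open>The frame jets with last entry \<open>0\<close> have dimension \<open>(k-1) \<cdot> kn \<cdot> n\<close>, that of the model space.\<close>

lemma frame_coordinates_exist: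
  assumes "DIM('e::euclidean_space) = CARD('k::{finite,linorder}) * (CARD('k) - 1) * CARD('n::finite)^2"
  obtains inc :: "'e::euclidean_space \<Rightarrow> ('n::finite, 'k::{finite,linorder}) frame_jet" and coord where "frame_coordinates inc coord"
proof -
  obtain l :: 'k where l: "pos l = CARD('k) - 1"
    using obtain_pos[OF last_index] by blast
  have last: "last_entry a = a $ l" for a :: "('n, 'k) frame_jet"
    unfolding last_entry_def l[symmetric] by simp
  let ?S = "{a :: ('n, 'k) frame_jet. last_entry a = 0}"
  have sub: "subspace ?S"
    by (auto simp: subspace_def last_entry_add linear_0[OF linear_last_entry] linear_cmul[OF linear_last_entry])
  have "dim (UNIV :: 'e set) = dim ?S"
    unfolding last dim_zero_component dim_UNIV assms by (simp add: power2_eq_square)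
  then obtain f :: "'e \<Rightarrow> ('n, 'k) frame_jet" and g where fg: "linear f" "linear g" "f ` UNIV = ?S" "g ` ?S = UNIV"
      "\<And>e. e \<in> UNIV \<Longrightarrow> norm (f e) = norm e" "\<And>a. a \<in> ?S \<Longrightarrow> norm (g a) = norm a"
      "\<And>e. e \<in> UNIV \<Longrightarrow> g (f e) = e" "\<And>a. a \<in> ?S \<Longrightarrow> f (g a) = a"
    by (rule isometries_subspaces[OF subspace_UNIV sub]) (rule that)
  have lin: "linear (\<lambda>a :: ('n, 'k) frame_jet. a - only_last (last_entry a))"
    by (rule linearI) (simp_all add: vec_eq_iff only_last_def last algebra_simps)
  have proj: "last_entry (a - only_last (last_entry a)) = 0" for a :: "('n, 'k) frame_jet"
    by (simp add: last only_last_def l)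
  have "frame_coordinates f (\<lambda>a. g (a - only_last (last_entry a)))"
  proof (rule frame_coordinates.intro)
    show "linear (\<lambda>a. g (a - only_last (last_entry a)))"
      using linear_compose[OF lin fg(2)] by (simp add: comp_def)
    show f0: "last_entry (f e) = 0" for e using fg(3) by blast
    show "g (f e - only_last (last_entry (f e))) = e" for e
      using f0[of e] fg(7) by (simp add: only_last_def zero_vec_def[symmetric] if_distrib cong: if_cong)
    show "f (g (a - only_last (last_entry a))) = a - only_last (last_entry a)" for a
      using fg(8) proj by blast
  qed (rule fg(1))
  then show ?thesis by (rule that)
qed

section \<open>The embedding\<close>

context frame_coordinates
begin

lemma fundamental_endomorphism_smooth_embedding:
  fixes \<B> :: "(('n, 'k) frame_jet set, 'e) chart set"
  assumes Y: "fanning_curve_jet_manifold Y \<B>"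
  shows "smooth_embedding Y \<B> euclidean (open_set_atlas UNIV) fundamental_endomorphism"
proof -
  have top: "topspace Y = fanning_curve_jets"
    and quot: "quotient_map (top_of_set fanning_frame_jets) Y curve_jet"
    and man: "smooth_manifold Y \<B>"
    and subm: "submersion (top_of_set fanning_frame_jets) (open_set_atlas fanning_frame_jets) Y \<B> curve_jet"
    using Y unfolding fanning_curve_jet_manifold_def quotient_manifold_def fanning_curve_jets_def
      curve_jet_def[abs_def] by simp_all
  have smo: "smooth_map (top_of_set fanning_frame_jets) (open_set_atlas fanning_frame_jets) Y \<B> curve_jet"
    using subm unfolding submersion_def by (elim conjE)
  have homeo: "homeomorphic_map Y (top_of_set (frame_endomorphism ` fanning_frame_jets)) fundamental_endomorphism"
    by (rule homeomorphic_map_fundamental_endomorphism[OF top quot])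
  have contF: "continuous_map Y euclidean fundamental_endomorphism"
    using homeomorphic_imp_continuous_map[OF homeo] by (simp add: continuous_map_in_subtopology)
  have chart: "smooth_on (fundamental_endomorphism \<circ> inv_into V \<psi>) (\<psi> ` V) \<and>
      (\<forall>y\<in>\<psi> ` V. inj (frechet_derivative (fundamental_endomorphism \<circ> inv_into V \<psi>) (at y)))"
    if V: "(V, \<psi>) \<in> \<B>" for V \<psi>
  proof -
    note ch = smooth_manifold_chartD[OF man V]
    let ?F = "fundamental_endomorphism \<circ> inv_into V \<psi>"
    define Q where "Q = {a \<in> fanning_frame_jets. curve_jet a \<in> V}"
    define q where "q = \<psi> \<circ> curve_jet"
    have "openin (top_of_set fanning_frame_jets) {a \<in> topspace (top_of_set fanning_frame_jets). curve_jet a \<in> V}"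
      by (rule openin_continuous_map_preimage[OF quotient_imp_continuous_map[OF quot] ch(1)])
    then have opQ: "open Q"
      unfolding Q_def using openin_open_trans[OF _ open_fanning_frame_jets] by simp
    have idQ: "id ` Q = Q" by simp
    have q_eq: "(\<psi> \<circ> curve_jet \<circ> inv_into fanning_frame_jets id) a = q a" if "a \<in> Q" for a
      using that f_inv_into_f[of a id fanning_frame_jets] by (simp add: Q_def q_def)
    have smq': "smooth_on (\<psi> \<circ> curve_jet \<circ> inv_into fanning_frame_jets id) Q"
      using smooth_map_chartD[OF smo _ V, of fanning_frame_jets id] unfolding Q_def[symmetric] idQ by simp
    have smq: "smooth_on q Q"
      by (rule smooth_on_cong[OF opQ smq' q_eq])
    have surjq: "surj (frechet_derivative q (at a))" if "a \<in> Q" for a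
    proof -
      have "surj (frechet_derivative (\<psi> \<circ> curve_jet \<circ> inv_into fanning_frame_jets id) (at a))"
        using submersion_chartD[OF subm _ V, of fanning_frame_jets id a] that by (simp add: Q_def)
      moreover have "frechet_derivative (\<psi> \<circ> curve_jet \<circ> inv_into fanning_frame_jets id) (at a) = frechet_derivative q (at a)"
        by (rule frechet_derivative_cong[OF opQ smq' that q_eq])
      ultimately show ?thesis by (rule back_subst[where P=surj])
    qed
    have Ckq: "Ck_on m q Q" for m using smq by (simp add: smooth_on_def)
    have q_diff: "q differentiable (at a)" if "a \<in> Q" for a
      by (rule Ck_on_differentiable[OF Ckq that])
    have contFV: "continuous_on (\<psi> ` V) ?F"
      using continuous_map_compose[OF smooth_manifold_chart_inverse_continuous[OF man V] contF] by simp
    have main: "\<exists>T. open T \<and> y0 \<in> T \<and> (\<forall>m. Ck_on m ?F T) \<and> inj (frechet_derivative ?F (at y0))"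
      if y0: "y0 \<in> \<psi> ` V" for y0
    proof -
      have F: "?F y \<in> frame_endomorphism ` fanning_frame_jets" "inv_into V \<psi> y \<in> fanning_curve_jets"
        if "y \<in> \<psi> ` V" for y
      proof -
        show "inv_into V \<psi> y \<in> fanning_curve_jets"
          using inv_into_into[OF that] ch(2) unfolding top by blast
        then show "?F y \<in> frame_endomorphism ` fanning_frame_jets"
          unfolding fundamental_endomorphism_image[symmetric] by simp
      qed
      obtain a0 where a0: "a0 \<in> fanning_frame_jets" "?F y0 = frame_endomorphism a0"
        using F(1)[OF y0] by blast
      define B where "B = last_entry a0"
      define T where "T = \<psi> ` V \<inter> (\<lambda>y. ladder_from (?F y) B) -` fanning_frame_jets"
      define h where "h y = coord (ladder_from (?F y) B)" for y
      \<comment> \<open>The slice through \<open>a0\<close> read in the chart \<open>\<psi>\<close>, and \<open>h\<close>, which is its inverse near \<open>y0\<close>.\<close>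
      let ?g = "\<lambda>e. q (slice B e)"
      let ?S = "{e. slice B e \<in> Q}"
      have contl: "continuous_on (\<psi> ` V) (\<lambda>y. ladder_from (?F y) B)"
        by (rule continuous_on_compose2[OF continuous_on_ladder_from[of UNIV] contFV]) simp
      have opT: "open T"
        unfolding T_def by (rule continuous_open_preimage[OF contl ch(3) open_fanning_frame_jets])
      have y0T: "y0 \<in> T"
        using y0 a0 ladder_from_frame_endomorphism[OF a0(1)] by (simp add: T_def B_def)
      have sl: "slice B (h y) = ladder_from (?F y) B" for y
        by (simp add: h_def slice_coord_ladder_from)
      have fan: "slice B (h y) \<in> fanning_frame_jets" if "y \<in> T" for y
        using that by (simp add: sl T_def)
      have Fsl: "frame_endomorphism (slice B (h y)) = ?F y" if "y \<in> T" for y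
        using that fan[OF that] F(1)[of y] unfolding sl
        by (intro frame_endomorphism_ladder_from) (auto simp: T_def)
      have cj: "curve_jet (slice B (h y)) = inv_into V \<psi> y" if "y \<in> T" for y
      proof (rule inj_onD[OF inj_on_fundamental_endomorphism])
        show "curve_jet (slice B (h y)) \<in> fanning_curve_jets"
          using fan[OF that] by (simp add: fanning_curve_jets_eq)
        show "inv_into V \<psi> y \<in> fanning_curve_jets" using F(2) that by (simp add: T_def)
        show "fundamental_endomorphism (curve_jet (slice B (h y))) = fundamental_endomorphism (inv_into V \<psi> y)"
          using fundamental_endomorphism_curve_jet[OF fan[OF that]] Fsl[OF that] by simp
      qed
      have yV: "y \<in> \<psi> ` V" if "y \<in> T" for y using that by (simp add: T_def)
      have hS: "slice B (h y) \<in> Q" if "y \<in> T" for y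
        using fan[OF that] cj[OF that] inv_into_into[OF yV[OF that]] by (simp add: Q_def)
      have gh: "?g (h y) = y" if "y \<in> T" for y
        using cj[OF that] f_inv_into_f[OF yV[OF that]] by (simp add: q_def)
      have conth: "continuous_on T h"
        unfolding h_def
        by (rule continuous_on_compose2[OF linear_continuous_on[OF linear_coord[unfolded linear_conv_bounded_linear], of UNIV]
              continuous_on_subset[OF contl]]) (auto simp: T_def)
      have Ckg: "Ck_on m ?g ?S" for m
        by (rule Ck_on_slice_compose[OF opQ Ckq])
      have bij: "bij (frechet_derivative ?g (at (h y)))" if y: "y \<in> T" for y
      proof -
        let ?s = "slice B (h y)"
        have s: "?s \<in> Q \<inter> chart_frames B"
          using hS[OF y] fan[OF y] by (simp add: slice_in_chart_frames)
        have ret: "retract B ?s = h y" by (rule retract_slice[OF fan[OF y]])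
        \<comment> \<open>\<open>q\<close> factors through the slice, so surjectivity of its derivative passes to \<open>?g\<close>.\<close>
        have qg: "q a = ?g (retract B a)" if "a \<in> Q \<inter> chart_frames B" for a
          using that slice_retract(3)[of a B] by (simp add: q_def)
        have gdiff: "?g differentiable (at (h y))"
          by (rule Ck_on_differentiable[OF Ckg]) (simp add: hS[OF y])
        have "frechet_derivative q (at ?s)
            = frechet_derivative ?g (at (retract B ?s)) \<circ> frechet_derivative (retract B) (at ?s)"
        proof (rule frechet_derivative_chain[where f="?g" and W="Q \<inter> chart_frames B"])
          show "open (Q \<inter> chart_frames B)" by (rule open_Int[OF opQ open_chart_frames])
          show "?s \<in> Q \<inter> chart_frames B" by (rule s)
          show "q a = ?g (retract B a)" if "a \<in> Q \<inter> chart_frames B" for a by (rule qg[OF that])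
          show "retract B differentiable (at ?s)"
            by (rule Ck_on_differentiable[OF Ck_on_retract]) (use s in auto)
          show "?g differentiable (at (retract B ?s))" unfolding ret by (rule gdiff)
        qed
        then have "surj (frechet_derivative ?g (at (h y)) \<circ> frechet_derivative (retract B) (at ?s))"
          using surjq[OF hS[OF y]] unfolding ret by simp
        then have "surj (frechet_derivative ?g (at (h y)))"
          by (rule surj_comp_left)
        moreover have "linear (frechet_derivative ?g (at (h y)))"
          using gdiff by (rule linear_frechet_derivative)
        ultimately show ?thesis
          using linear_surjective_imp_injective[OF _ _ refl] unfolding bij_def by blast
      qed
      have Ckh: "Ck_on m h T" for m
        by (rule Ck_on_inverse_function[OF opT Ckg conth _ gh bij]) (auto simp: hS)
      \<comment> \<open>In the chart, \<open>F\<close> is \<open>h\<close> followed by the slice and by \<open>F\<close> on frames.\<close>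
      have CkF: "Ck_on m ?F T" for m
      proof (rule Ck_on_cong[OF opT])
        have "Ck_on m (\<lambda>y. slice B (h y)) T"
          by (rule Ck_on_compose[OF opT Ckh Ck_on_slice]) simp
        then show "Ck_on m (\<lambda>y. frame_endomorphism (slice B (h y))) T"
          by (rule Ck_on_compose[OF opT _ Ck_on_frame_endomorphism]) (auto simp: fan)
      qed (rule Fsl)
      have "frechet_derivative (\<lambda>M. q (ladder_from M B)) (at (?F y0)) \<circ> frechet_derivative ?F (at y0) = id"
      proof (rule frechet_derivative_local_inverse[OF opT y0T])
        show "?F differentiable (at y0)" by (rule Ck_on_differentiable[OF CkF y0T])
        have op: "open ((\<lambda>M. ladder_from M B) -` Q)"
          by (rule open_vimage[OF opQ continuous_on_ladder_from])
        have "Ck_on m (\<lambda>M. q (ladder_from M B)) ((\<lambda>M. ladder_from M B) -` Q)" for m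
          by (rule Ck_on_compose[OF op Ck_on_subset[OF Ck_on_ladder_from] Ckq]) auto
        then show "(\<lambda>M. q (ladder_from M B)) differentiable (at (?F y0))"
          by (rule Ck_on_differentiable) (use hS[OF y0T] sl in simp)
        show "q (ladder_from (?F y) B) = y" if "y \<in> T" for y
          using gh[OF that] by (simp only: sl)
      qed
      then have "inj (frechet_derivative ?F (at y0))"
        by (metis inj_on_id inj_on_imageI2)
      with opT y0T CkF show ?thesis by blast
    qed
    then show ?thesis
      unfolding smooth_on_def by (meson Ck_on_local)
  qed
  have img: "\<psi> ` {c \<in> V. fundamental_endomorphism c \<in> UNIV} = \<psi> ` V"
    for V and \<psi> :: "('n, 'k) frame_jet set \<Rightarrow> 'e" by simp
  have "immersion Y \<B> euclidean (open_set_atlas UNIV) fundamental_endomorphism"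
    unfolding immersion_def smooth_map_def
  proof (intro conjI contF ball_pairI ballI impI)
    fix V \<psi> W \<phi> assume V: "(V, \<psi>) \<in> \<B>" and "(W, \<phi>) \<in> open_set_atlas (UNIV :: ('n, 'k) big_matrix set)"
    then have W: "W = UNIV" "\<phi> = id" by auto
    show "smooth_on (\<phi> \<circ> fundamental_endomorphism \<circ> inv_into V \<psi>) (\<psi> ` {c \<in> V. fundamental_endomorphism c \<in> W})"
      using chart[OF V] unfolding W img id_comp by blast
    show "inj (frechet_derivative (\<phi> \<circ> fundamental_endomorphism \<circ> inv_into V \<psi>) (at (\<psi> c)))" if "c \<in> V" for c
      using chart[OF V] that unfolding W img id_comp by blast
  qed
  moreover have "embedding_map Y euclidean fundamental_endomorphism"
    unfolding embedding_map_def top fundamental_endomorphism_image by (rule homeo)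
  ultimately show ?thesis by (simp add: smooth_embedding_def)
qed

end

text \<open>The orbit is that of \<open>block_nilpotent\<close>, and the atlas on it is the one carried over from the space of jets.\<close>

theorem proposition4p7:
  assumes k: "CARD('k::{finite,linorder}) \<ge> 2"
    and dim: "DIM('e::euclidean_space) = CARD('k) * (CARD('k) - 1) * CARD('n::finite)^2"
  shows
    "(\<exists>(Y :: ('n, 'k) frame_jet set topology) (\<B> :: (('n, 'k) frame_jet set, 'e) chart set).
        fanning_curve_jet_manifold Y \<B>) \<and>
     (\<forall>a \<in> (fanning_frame_jets :: ('n, 'k) frame_jet set).
        fundamental_endomorphism (curve_jet a) =
          juxtapose a ** block_nilpotent ** matrix_inv (juxtapose a)) \<and>
     (\<forall>(T :: ('n, 'k) big_matrix). \<forall>c\<in>fanning_curve_jets. invertible T \<longrightarrow>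
        fundamental_endomorphism (curve_jet_act T c) = adjoint_act T (fundamental_endomorphism c)) \<and>
     (\<exists>(M :: ('n, 'k) big_matrix).
        fundamental_endomorphism ` fanning_curve_jets = adjoint_orbit M) \<and>
     (\<forall>(Y :: ('n, 'k) frame_jet set topology) (\<B> :: (('n, 'k) frame_jet set, 'e) chart set).
        fanning_curve_jet_manifold Y \<B> \<longrightarrow>
          smooth_embedding Y \<B> euclidean (open_set_atlas UNIV) fundamental_endomorphism \<and>
          (\<exists>\<C> :: (('n, 'k) big_matrix, 'e) chart set.
             embedded_submanifold (fundamental_endomorphism ` fanning_curve_jets) \<C>
               euclidean (open_set_atlas UNIV) \<and>
             diffeomorphism Y \<B>
               (subtopology euclidean (fundamental_endomorphism ` fanning_curve_jets)) \<C>
               fundamental_endomorphism))"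
proof -
  obtain inc :: "'e \<Rightarrow> ('n, 'k) frame_jet" and coord where "frame_coordinates inc coord"
    using frame_coordinates_exist[OF dim] by blast
  then interpret frame_coordinates inc coord .
  show ?thesis
  proof (intro conjI allI ballI impI)
    show "\<exists>(Y :: ('n, 'k) frame_jet set topology) (\<B> :: (('n, 'k) frame_jet set, 'e) chart set).
        fanning_curve_jet_manifold Y \<B>"
      using fanning_curve_jet_manifold_exists by blast
    show "fundamental_endomorphism (curve_jet a) =
        juxtapose a ** block_nilpotent ** matrix_inv (juxtapose a)"
      if "a \<in> fanning_frame_jets" for a :: "('n, 'k) frame_jet"
      using fundamental_endomorphism_curve_jet[OF that] by (simp add: frame_endomorphism_def)
    show "fundamental_endomorphism (curve_jet_act T c) = adjoint_act T (fundamental_endomorphism c)"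
      if "c \<in> fanning_curve_jets" "invertible T" for T :: "('n, 'k) big_matrix" and c
      by (rule fundamental_endomorphism_equivariant[OF that(2,1)])
    show "\<exists>M :: ('n, 'k) big_matrix. fundamental_endomorphism ` fanning_curve_jets = adjoint_orbit M"
      using fundamental_endomorphism_image frame_endomorphism_image by metis
    fix Y :: "('n, 'k) frame_jet set topology" and \<B> :: "(('n, 'k) frame_jet set, 'e) chart set"
    assume Y: "fanning_curve_jet_manifold Y \<B>"
    have man: "smooth_manifold Y \<B>" and top: "topspace Y = fanning_curve_jets"
      using Y by (simp_all add: fanning_curve_jet_manifold_def quotient_manifold_def fanning_curve_jets_def)
    show emb: "smooth_embedding Y \<B> euclidean (open_set_atlas UNIV) fundamental_endomorphism"
      by (rule fundamental_endomorphism_smooth_embedding[OF Y])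
    have "smooth_manifold euclidean (open_set_atlas (UNIV :: ('n, 'k) big_matrix set))"
      using smooth_manifold_open_set_atlas[OF open_UNIV] by simp
    from smooth_embedding_image[OF man this emb]
    show "\<exists>\<C> :: (('n, 'k) big_matrix, 'e) chart set.
        embedded_submanifold (fundamental_endomorphism ` fanning_curve_jets) \<C>
          euclidean (open_set_atlas UNIV) \<and>
        diffeomorphism Y \<B> (subtopology euclidean (fundamental_endomorphism ` fanning_curve_jets)) \<C>
          fundamental_endomorphism"
      unfolding top .
  qed
qed

end
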